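(* Fix $\delta\in\mathbb{N}$. For every $n\in\mathbb{N}$ there exists $j\in\mathbb{N}$ such that the Toeplitz operator $T_{\varphi}$ on the Bergman space $A^{2}(\mathbb{D})$ with symbol \[ \varphi(z)=z^{n+\delta}\bar{z}^{n}+\frac{1}{2j+\delta}\,\bar{z}^{j+\delta}z^{j} \] is hyponormal.
   Context: $\mathbb{N}=\{1,2,3,\dots\}$. $\mathbb{D}$ is the open unit disc in $\mathbb{C}$. The Bergman space is $A^{2}(\mathbb{D})=\{f \text{ holomorphic on }\mathbb{D}:\int_{\mathbb{D}}|f(z)|^{2}\,dA(z)<\infty\}$, where $dA$ is area measure, regarded as a closed subspace of $L^{2}(\mathbb{D})$. For $\varphi\in L^{\infty}(\mathbb{D})$, the Toeplitz operator is $T_{\varphi}f=P(\varphi f)$ for $f\in A^{2}(\mathbb{D})$, where $P$ is the orthogonal projection from $L^{2}(\mathbb{D})$ onto $A^{2}(\mathbb{D})$. A bounded operator $T$ on a complex Hilbert space $H$ is hyponormal if $[T^{*},T]:=T^{*}T-TT^{*}\ge 0$, i.e. $\langle [T^{*},T]u,u\rangle\ge 0$ for all $u\in H$. *)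

theory Defs
  imports "HOL-Complex_Analysis.Complex_Analysis"
begin

text \<open>Unnormalised area measure on the open unit disc.\<close>

abbreviation disc_area :: "complex measure" where
  "disc_area \<equiv> lebesgue_on (ball 0 1)"

text \<open>Elements of \<open>L\<^sup>2\<close> are represented by functions, not by classes of functions that
  agree almost everywhere; the values outside the disc are irrelevant.\<close>

definition L2_disc :: "(complex \<Rightarrow> complex) set" where
  "L2_disc = {f. f \<in> borel_measurable disc_area \<and> integrable disc_area (\<lambda>z. (norm (f z))\<^sup>2)}"

definition L2_inner :: "(complex \<Rightarrow> complex) \<Rightarrow> (complex \<Rightarrow> complex) \<Rightarrow> complex" where
  "L2_inner f g = (LINT z|disc_area. f z * cnj (g z))"

definition L2_norm :: "(complex \<Rightarrow> complex) \<Rightarrow> real" where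
  "L2_norm f = sqrt (LINT z|disc_area. (norm (f z))\<^sup>2)"

text \<open>HOL functions are total, so a function on the disc is represented by its extension by
  zero. Elements of the Bergman space are then equal iff they agree on the disc, which makes
  the definite descriptions below meaningful.\<close>

definition bergman_space :: "(complex \<Rightarrow> complex) set" where
  "bergman_space = {f \<in> L2_disc. f holomorphic_on ball 0 1 \<and> (\<forall>z. z \<notin> ball 0 1 \<longrightarrow> f z = 0)}"

text \<open>Intended for \<open>g \<in> L2_disc\<close>.\<close>

definition bergman_projection :: "(complex \<Rightarrow> complex) \<Rightarrow> (complex \<Rightarrow> complex)" where
  "bergman_projection g =
     (THE h. h \<in> bergman_space \<and> (\<forall>k\<in>bergman_space. L2_inner (\<lambda>z. g z - h z) k = 0))"

text \<open>Intended for essentially bounded measurable symbols.\<close>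

definition toeplitz :: "(complex \<Rightarrow> complex) \<Rightarrow> (complex \<Rightarrow> complex) \<Rightarrow> (complex \<Rightarrow> complex)" where
  "toeplitz \<phi> f = bergman_projection (\<lambda>z. \<phi> z * f z)"

definition bounded_operator :: "((complex \<Rightarrow> complex) \<Rightarrow> (complex \<Rightarrow> complex)) \<Rightarrow> bool" where
  "bounded_operator T \<longleftrightarrow>
     (\<forall>u\<in>bergman_space. T u \<in> bergman_space) \<and>
     (\<forall>u\<in>bergman_space. \<forall>v\<in>bergman_space. T (\<lambda>z. u z + v z) = (\<lambda>z. T u z + T v z)) \<and>
     (\<forall>c. \<forall>u\<in>bergman_space. T (\<lambda>z. c * u z) = (\<lambda>z. c * T u z)) \<and>
     (\<exists>C. \<forall>u\<in>bergman_space. L2_norm (T u) \<le> C * L2_norm u)"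

definition hilbert_adjoint ::
  "((complex \<Rightarrow> complex) \<Rightarrow> (complex \<Rightarrow> complex)) \<Rightarrow> (complex \<Rightarrow> complex) \<Rightarrow> (complex \<Rightarrow> complex)" where
  "hilbert_adjoint T v =
     (THE w. w \<in> bergman_space \<and> (\<forall>u\<in>bergman_space. L2_inner (T u) v = L2_inner u w))"

definition self_commutator ::
  "((complex \<Rightarrow> complex) \<Rightarrow> (complex \<Rightarrow> complex)) \<Rightarrow> (complex \<Rightarrow> complex) \<Rightarrow> (complex \<Rightarrow> complex)" where
  "self_commutator T u = (\<lambda>z. hilbert_adjoint T (T u) z - T (hilbert_adjoint T u) z)"

definition hyponormal :: "((complex \<Rightarrow> complex) \<Rightarrow> (complex \<Rightarrow> complex)) \<Rightarrow> bool" where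
  "hyponormal T \<longleftrightarrow> bounded_operator T \<and>
     (\<forall>u\<in>bergman_space. L2_inner (self_commutator T u) u \<in> \<real>\<^sub>\<ge>\<^sub>0)"

end

theory Submission imports Defs begin

text \<open>For \<open>j = n\<close> the symbol is \<open>f + c * cnj f\<close> with \<open>f z = z\<^bsup>n+\<delta>\<^esup> * (cnj z)\<^bsup>n\<^esup>\<close> and the real number
  \<open>c = 1 / (2 * n + \<delta>)\<close>, which lies in \<open>[0, 1]\<close>. The Toeplitz operator with the conjugate symbol
  is the adjoint, so the operator in question is \<open>T = A + c A\<^sup>*\<close> with \<open>A = T\<^sub>f\<close>, and
  \<open>T\<^sup>*T - TT\<^sup>* = (1 - c\<^sup>2) (A\<^sup>*A - AA\<^sup>*)\<close> (\<open>hyponormal_toeplitz_add_cnj\<close>). It remains to see that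
  \<open>A\<close> is hyponormal, that is, that the image of \<open>u\<close> under \<open>A\<^sup>*\<close> is never longer than its image under
  \<open>A\<close> (\<open>L2_norm_toeplitz_monomial_cnj_le\<close>).

  In the orthogonal basis of the powers of \<open>z\<close>, the operator \<open>A\<close> is a weighted shift:
  it maps \<open>z\<^sup>k\<close> to \<open>(k + \<delta> + 1) / (n + k + \<delta> + 1)\<close> times \<open>z\<^bsup>k+\<delta>\<^esup>\<close>, and \<open>A\<^sup>*\<close> shifts back
  by \<open>\<delta>\<close> (\<open>monomial_coeff_toeplitz_monomial\<close>). Relative to the normalised basis the weights of
  \<open>A\<close> increase along each chain \<open>k, k + \<delta>, k + 2\<delta>, \<dots>\<close>; after a common factor is cancelled, this is
  the elementary inequality \<open>shift_weight_le\<close>, and it yields hyponormality coefficient by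
  coefficient.

  The analytic basis consists of three facts. The moments of the disc show that the powers of \<open>z\<close>
  are orthogonal with squared norms \<open>pi / (k + 1)\<close> (\<open>ball_moment_offdiagonal\<close>,
  \<open>radial_moment\<close>). Square summable coefficients define Bergman functions by a series that converges
  in the mean (\<open>disc_series_tail\<close>), and every Bergman function arises in this way
  (\<open>bergman_expansion\<close>). These give an explicit formula for the Bergman projection
  (\<open>bergman_projection_eq\<close>) and Parseval's identity (\<open>Parseval_bergman\<close>).\<close>

section \<open>Area measure of the plane\<close>

text \<open>Rotation invariance is inherited from the change of variables formula on \<open>real^2\<close>, where
  orthogonal maps have determinant \<open>1\<close> or \<open>-1\<close>; the next lemma then identifies the plane
  \<open>complex\<close> with \<open>real^2\<close>.\<close>

lemma lborel_distr_orthogonal: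
  fixes R :: "real^'n::{finite,wellorder} \<Rightarrow> real^'n::_"
  assumes R: "orthogonal_transformation R"
  shows "distr lborel borel R = lborel"
proof (rule lborel_eqI[symmetric])
  have meas: "R \<in> borel_measurable borel"
    by (intro borel_measurable_continuous_onI linear_continuous_on)
       (simp add: R linear_conv_bounded_linear[symmetric] orthogonal_transformation_linear)
  obtain R' where R': "orthogonal_transformation R'" "\<And>x. R' (R x) = x" "\<And>x. R (R' x) = x"
    using R by (metis orthogonal_transformation_inv orthogonal_transformation_inj
        orthogonal_transformation_surj inv_f_f surj_f_inv_f)
  fix l u :: "real^'n::{finite,wellorder}"
  assume le: "\<And>b. b \<in> Basis \<Longrightarrow> l \<bullet> b \<le> u \<bullet> b"
  have img: "R -` box l u = R' ` box l u"
    using R' by (auto simp: image_iff) metis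
  have sets: "R -` box l u \<in> sets borel"
    using measurable_sets[OF meas, of "box l u"] by simp
  have lm: "R' ` box l u \<in> lmeasurable"
    by (intro measurable_orthogonal_image R'(1) lmeasurable_box)
  have "emeasure (distr lborel borel R) (box l u) = emeasure lborel (R' ` box l u)"
    using meas by (simp add: emeasure_distr img)
  also have "\<dots> = emeasure lebesgue (R' ` box l u)"
    using sets img by simp
  also have "\<dots> = measure lebesgue (R' ` box l u)"
    using lm by (simp add: emeasure_eq_measure2)
  also have "\<dots> = measure lebesgue (box l u)"
    by (simp add: measure_orthogonal_image R')
  also have "\<dots> = (\<Prod>b\<in>Basis. (u - l) \<bullet> b)"
    using le by (simp add: measure_lborel_box_eq inner_diff_left)
  finally show "emeasure (distr lborel borel R) (box l u) = (\<Prod>b\<in>Basis. (u - l) \<bullet> b)" .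
qed simp

lemma lborel_distr_real2_complex:
  "distr lborel borel (\<lambda>v::real^2. Complex (v $ 1) (v $ 2)) = lborel"
proof (rule lborel_eqI[symmetric])
  let ?F = "\<lambda>v::real^2. Complex (v $ 1) (v $ 2)"
  have meas: "?F \<in> borel_measurable borel"
    by (intro borel_measurable_continuous_onI) (auto simp: Complex_eq intro!: continuous_intros)
  fix l u :: complex
  assume le: "\<And>b. b \<in> Basis \<Longrightarrow> l \<bullet> b \<le> u \<bullet> b"
  define l' u' :: "real^2" where "l' = vector [Re l, Im l]" and "u' = vector [Re u, Im u]"
  have [simp]: "l' $ 1 = Re l" "l' $ 2 = Im l" "u' $ 1 = Re u" "u' $ 2 = Im u"
    by (simp_all add: l'_def u'_def)
  have le': "Re l \<le> Re u" "Im l \<le> Im u"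
    using le[of 1] le[of \<i>] by (auto simp: Basis_complex_def)
  have vi: "?F -` box l u = box l' u'"
    by (auto simp: in_box_complex_iff mem_box_cart forall_2)
  have le2: "\<And>b. b \<in> Basis \<Longrightarrow> l' \<bullet> b \<le> u' \<bullet> b"
    using le' by (auto simp: Basis_vec_def inner_axis exhaust_2)
      (metis exhaust_2 \<open>l' $ 1 = Re l\<close> \<open>l' $ 2 = Im l\<close> \<open>u' $ 1 = Re u\<close> \<open>u' $ 2 = Im u\<close>)
  have "emeasure (distr lborel borel ?F) (box l u) = emeasure lborel (box l' u')"
    using meas by (simp add: emeasure_distr vi)
  also have "\<dots> = (\<Prod>b\<in>Basis. (u' - l') \<bullet> b)"
    using le2 by (simp add: emeasure_lborel_box_eq)
  also have "(\<Prod>b\<in>Basis. (u' - l') \<bullet> b) = (\<Prod>i\<in>UNIV. (u' - l') $ i)"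
  proof -
    have B: "(Basis :: (real^2) set) = (\<lambda>i. axis i 1) ` UNIV"
      by (auto simp: Basis_vec_def)
    have inj: "inj (\<lambda>i::2. axis i (1::real))"
      by (auto simp: inj_on_def axis_eq_axis)
    have "(\<Prod>b\<in>Basis. (u' - l') \<bullet> b) = (\<Prod>i\<in>UNIV. (u' - l') \<bullet> axis i 1)"
      unfolding B by (subst prod.reindex[OF inj]) (simp add: o_def)
    then show ?thesis by (simp add: inner_axis)
  qed
  also have "\<dots> = (\<Prod>b\<in>Basis. (u - l) \<bullet> b)"
    by (simp add: UNIV_2 Basis_complex_def)
  finally show "emeasure (distr lborel borel ?F) (box l u) = (\<Prod>b\<in>Basis. (u - l) \<bullet> b)" .
qed simp

lemma lborel_distr_complex_rotation:
  fixes w :: complex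
  assumes w: "norm w = 1"
  shows "distr lborel borel (\<lambda>z. w * z) = lborel"
proof -
  let ?F = "\<lambda>v::real^2. Complex (v $ 1) (v $ 2)"
  define R :: "real^2 \<Rightarrow> real^2" where
    "R v = vector [Re w * v $ 1 - Im w * v $ 2, Re w * v $ 2 + Im w * v $ 1]" for v
  have [measurable]: "?F \<in> borel_measurable borel"
    by (intro borel_measurable_continuous_onI) (auto simp: Complex_eq intro!: continuous_intros)
  have w2: "(Re w)\<^sup>2 + (Im w)\<^sup>2 = 1"
    using w by (simp add: cmod_def)
  have lin: "linear R"
    by (intro linearI) (auto simp: R_def vec_eq_iff forall_2 algebra_simps)
  have "norm (R v) = norm v" for v
  proof -
    have "(norm (R v))\<^sup>2 = ((Re w)\<^sup>2 + (Im w)\<^sup>2) * ((v $ 1)\<^sup>2 + (v $ 2)\<^sup>2)"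
      unfolding power2_norm_eq_inner
      by (simp add: inner_vec_def sum_2 R_def) (simp add: algebra_simps power2_eq_square)
    also have "\<dots> = (norm v)\<^sup>2"
      unfolding power2_norm_eq_inner w2 by (simp add: inner_vec_def sum_2 power2_eq_square)
    finally show ?thesis by (simp add: power2_eq_iff_nonneg)
  qed
  then have orth: "orthogonal_transformation R"
    using lin by (simp add: orthogonal_transformation)
  have [measurable]: "R \<in> borel_measurable borel"
    using lin by (intro borel_measurable_continuous_onI linear_continuous_on)
       (simp add: linear_conv_bounded_linear[symmetric])
  have comm: "(\<lambda>z. w * z) \<circ> ?F = ?F \<circ> R"
    by (auto simp: R_def complex_eq_iff fun_eq_iff)
  have "distr lborel borel (\<lambda>z. w * z) = distr (distr lborel borel ?F) borel (\<lambda>z. w * z)"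
    by (simp add: lborel_distr_real2_complex)
  also have "\<dots> = distr (distr lborel borel R) borel ?F"
    by (subst (1 2) distr_distr) (simp_all only: comm, measurable)
  also have "\<dots> = lborel"
    by (simp add: lborel_distr_orthogonal[OF orth] lborel_distr_real2_complex)
  finally show ?thesis .
qed

lemma lborel_distr_complex_scale:
  fixes r :: real
  assumes "r > 0"
  shows "(lborel :: complex measure) = density (distr lborel borel (\<lambda>z. of_real r * z)) (\<lambda>_. r\<^sup>2)"
proof -
  have "(\<Sum>j\<in>Basis. (r * (x \<bullet> j)) *\<^sub>R j) = of_real r * x" for x :: complex
    by (simp add: Basis_complex_def complex_eq_iff)
  then show ?thesis
    using lborel_affine_euclidean[of "\<lambda>_. r" "0::complex"] assms
    by (simp add: Basis_complex_def power2_eq_square)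
qed

section \<open>Moments of the disc\<close>

lemma ball_in_sets_borel [measurable]: "ball (c::'a::metric_space) r \<in> sets borel"
  by simp

lemma integral_lebesgue_on_ball:
  fixes f :: "complex \<Rightarrow> 'b::{banach, second_countable_topology}"
  assumes [measurable]: "f \<in> borel_measurable borel"
  shows "(LINT z|lebesgue_on (ball 0 r). f z) = (LINT z|lborel. indicator (ball 0 r) z *\<^sub>R f z)"
  by (subst integral_restrict_space) (auto intro!: integral_completion)

lemma integral_ball_rotation:
  fixes f :: "complex \<Rightarrow> 'b::{banach, second_countable_topology}"
  assumes f[measurable]: "f \<in> borel_measurable borel" and w: "norm w = 1"
  shows "(LINT z|lebesgue_on (ball 0 r). f (w * z)) = (LINT z|lebesgue_on (ball 0 r). f z)"
proof -
  have "(LINT z|lborel. indicator (ball 0 r) z *\<^sub>R f z)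
      = (LINT z|distr lborel borel (\<lambda>z. w * z). indicator (ball 0 r) z *\<^sub>R f z)"
    by (simp add: lborel_distr_complex_rotation[OF w])
  also have "\<dots> = (LINT z|lborel. indicator (ball 0 r) (w * z) *\<^sub>R f (w * z))"
    by (rule integral_distr) measurable
  also have "\<dots> = (LINT z|lborel. indicator (ball 0 r) z *\<^sub>R f (w * z))"
    using w by (intro Bochner_Integration.integral_cong) (auto simp: indicator_def norm_mult)
  finally show ?thesis by (simp add: integral_lebesgue_on_ball)
qed

lemma measurable_monomial [measurable]:
  "(\<lambda>z::complex. z ^ m * cnj z ^ k) \<in> borel_measurable borel"
  by (intro borel_measurable_continuous_onI continuous_intros)

text \<open>The rotation \<open>w\<close> by the angle \<open>\<pi> / (m - k)\<close> preserves area and the ball but multiplies the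
  integrand by \<open>w\<^sup>m * (cnj w)\<^sup>k = -1\<close>, so the integral equals its own negative.\<close>

lemma ball_moment_offdiagonal:
  assumes "m \<noteq> k"
  shows "(LINT z|lebesgue_on (ball 0 r). z ^ m * cnj z ^ k) = 0"
proof -
  define w where "w = cis (pi / (real m - real k))"
  have w: "norm w = 1" by (simp add: w_def)
  have wmk: "w ^ m * cnj w ^ k = -1"
  proof -
    have "w ^ m * cnj w ^ k = cis ((real m - real k) * (pi / (real m - real k)))"
      by (simp only: w_def cis_cnj Complex.DeMoivre cis_mult)
         (simp only: left_diff_distrib mult_minus_right add_uminus_conv_diff)
    then show ?thesis using assms by simp
  qed
  have "(LINT z|lebesgue_on (ball 0 r). z ^ m * cnj z ^ k)
      = (LINT z|lebesgue_on (ball 0 r). (w * z) ^ m * cnj (w * z) ^ k)"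
    using integral_ball_rotation[OF measurable_monomial w] by simp
  also have "\<dots> = (LINT z|lebesgue_on (ball 0 r). (w ^ m * cnj w ^ k) * (z ^ m * cnj z ^ k))"
    by (simp add: power_mult_distrib mult_ac)
  also have "\<dots> = - (LINT z|lebesgue_on (ball 0 r). z ^ m * cnj z ^ k)"
    unfolding wmk by simp
  finally show ?thesis by simp
qed

lemma radial_moment_scale:
  assumes "r > 0"
  shows "(LINT z|lborel. indicator (ball 0 r) z * norm (z::complex) ^ (2*k))
       = r ^ (2*k+2) * (LINT z|lborel. indicator (ball 0 1) z * norm (z::complex) ^ (2*k))"
proof -
  let ?f = "\<lambda>z::complex. indicator (ball 0 r) z * norm z ^ (2*k) :: real"
  have "(LINT z|lborel. ?f z)
      = (LINT z|density (distr lborel borel (\<lambda>z. of_real r * z)) (\<lambda>_. ennreal (r\<^sup>2)). ?f z)"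
    using lborel_distr_complex_scale[OF assms] by simp
  also have "\<dots> = r\<^sup>2 * (LINT z|distr lborel borel (\<lambda>z::complex. of_real r * z). ?f z)"
    by (subst integral_density) auto
  also have "(LINT z|distr lborel borel (\<lambda>z. of_real r * z). ?f z) = (LINT z|lborel. ?f (of_real r * z))"
    by (rule integral_distr) measurable
  also have "\<dots> = (LINT z|lborel. r ^ (2*k) * (indicator (ball 0 1) z * norm (z::complex) ^ (2*k)))"
    using assms
    by (intro Bochner_Integration.integral_cong) (auto simp: indicator_def norm_mult power_mult_distrib)
  finally show ?thesis
    by (simp add: power2_eq_square)
qed

lemma measure_ball_complex: "r \<ge> 0 \<Longrightarrow> measure lborel (ball (0::complex) r) = pi * r\<^sup>2"
  by (simp add: content_ball unit_ball_vol_2)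

lemma integrable_ball_radial:
  "integrable lborel (\<lambda>z::complex. indicator (ball 0 r) z * norm z ^ k)"
  if "0 < r" "r \<le> 1"
proof (rule Bochner_Integration.integrable_bound)
  show "integrable lborel (indicator (ball (0::complex) r) :: _ \<Rightarrow> real)"
    using that by (simp add: integrable_indicator_iff emeasure_ball)
  show "AE z in lborel. norm (indicator (ball 0 r) z * norm (z::complex) ^ k) \<le> norm (indicator (ball 0 r) z :: real)"
    using that by (intro AE_I2) (auto simp: indicator_def intro!: power_le_one)
qed measurable

text \<open>Polar coordinates are avoided by a self-similarity argument. If \<open>I\<close> is the moment and
  \<open>s = r\<^sup>2\<close>, then scaling shows that the annulus \<open>r \<le> norm z < 1\<close> contributes
  \<open>(1 - s\<^sup>k\<^sup>+\<^sup>1) * I\<close>. There the integrand lies between \<open>s\<^sup>k\<close> and \<open>1\<close>, and the area is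
  \<open>pi * (1 - s)\<close>. After division by \<open>1 - s\<close>, the limit \<open>s \<rightarrow> 1\<close> gives \<open>(k + 1) * I = pi\<close>.\<close>

lemma radial_moment:
  "(LINT z|lborel. indicator (ball 0 1) z * norm (z::complex) ^ (2*k)) = pi / (real k + 1)"
proof -
  define I where "I = (LINT z|lborel. indicator (ball 0 1) z * norm (z::complex) ^ (2*k))"
  have bounds: "s ^ k * pi \<le> (\<Sum>i\<le>k. s ^ i) * I \<and> (\<Sum>i\<le>k. s ^ i) * I \<le> pi"
    if s: "0 < s" "s < 1" for s
  proof -
    define r where "r = sqrt s"
    have r: "0 < r" "r < 1" "r\<^sup>2 = s" using s by (auto simp: r_def real_sqrt_lt_1_iff)
    define A where "A = ball (0::complex) 1 - ball 0 r"
    have A[measurable]: "A \<in> sets lborel" by (simp add: A_def)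
    have sub: "ball (0::complex) r \<subseteq> ball 0 1" using r by auto
    have mA: "measure lborel A = pi * (1 - s)"
      unfolding A_def using r sub
      by (subst measure_Diff) (auto simp: measure_ball_complex emeasure_ball algebra_simps)
    have fA: "emeasure lborel A < \<infinity>"
      by (rule le_less_trans[OF emeasure_mono[of A "ball 0 1"]]) (auto simp: A_def emeasure_ball)
    have "(LINT z|lborel. indicator A z * norm z ^ (2*k))
        = (LINT z|lborel. indicator (ball 0 1) z * norm z ^ (2*k) - indicator (ball 0 r) z * norm (z::complex) ^ (2*k))"
      using sub by (intro Bochner_Integration.integral_cong) (auto simp: A_def indicator_def)
    also have "\<dots> = I - r ^ (2*k+2) * I"
      using r unfolding I_def
      by (subst Bochner_Integration.integral_diff) (auto simp: integrable_ball_radial radial_moment_scale[OF r(1)] simp del: power_Suc)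
    also have "\<dots> = (1 - s ^ Suc k) * I"
      by (simp add: algebra_simps power2_eq_square power_mult_distrib mult_ac power_mult flip: r(3))
    also have "1 - s ^ Suc k = (1 - s) * (\<Sum>i\<le>k. s ^ i)"
      using sum_gp_basic[of s k] by simp
    finally have J: "(LINT z|lborel. indicator A z * norm z ^ (2*k)) = (1 - s) * ((\<Sum>i\<le>k. s ^ i) * I)"
      by simp
    have int1: "integrable lborel (\<lambda>z. indicator A z * norm z ^ (2*k))"
      by (rule Bochner_Integration.integrable_bound[OF integrable_ball_radial[of 1 "2*k"]])
         (auto simp: A_def indicator_def)
    have int2: "integrable lborel (\<lambda>z. indicator A z * c)" for c :: real
      using fA A by (intro integrable_mult_left) (simp add: integrable_indicator_iff)
    have "(LINT z|lborel. indicator A z * s ^ k) \<le> (LINT z|lborel. indicator A z * norm z ^ (2*k))"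
    proof (rule integral_mono[OF int2 int1])
      fix z
      show "indicator A z * s ^ k \<le> indicator A z * norm z ^ (2 * k)"
        using r by (auto simp: A_def indicator_def power_mult simp flip: r(3) intro!: power_mono)
    qed
    moreover have "(LINT z|lborel. indicator A z * s ^ k) = (1 - s) * (s ^ k * pi)"
      using mA by simp
    ultimately have 1: "(1 - s) * (s ^ k * pi) \<le> (1 - s) * ((\<Sum>i\<le>k. s ^ i) * I)"
      by (simp only: J)
    have "(LINT z|lborel. indicator A z * norm z ^ (2*k)) \<le> (LINT z|lborel. indicator A z * 1)"
      by (rule integral_mono[OF int1 int2]) (auto simp: A_def indicator_def intro!: power_le_one)
    moreover have "(LINT z|lborel. indicator A z * 1) = (1 - s) * pi"
      using mA by simp
    ultimately have 2: "(1 - s) * ((\<Sum>i\<le>k. s ^ i) * I) \<le> (1 - s) * pi"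
      by (simp only: J)
    show ?thesis
      using 1 2 s by (simp only: mult_le_cancel_left_pos[of "1 - s"])
  qed
  have ev: "eventually (\<lambda>s::real. 0 < s \<and> s < 1) (at_left 1)"
    unfolding eventually_at_left_field by (rule exI[of _ 0]) simp
  have lim1: "((\<lambda>s. (\<Sum>i\<le>k. s ^ i) * I) \<longlongrightarrow> (\<Sum>i\<le>k. 1 ^ i) * I) (at_left 1)"
    by (intro tendsto_intros)
  have lim2: "((\<lambda>s. s ^ k * pi) \<longlongrightarrow> 1 ^ k * pi) (at_left 1)"
    by (intro tendsto_intros)
  have "(\<Sum>i\<le>k. 1 ^ i) * I \<le> pi"
    by (rule tendsto_upperbound[OF lim1]) (use ev bounds in \<open>auto elim!: eventually_mono\<close>)
  moreover have "1 ^ k * pi \<le> (\<Sum>i\<le>k. 1 ^ i) * I"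
    by (rule tendsto_le[OF _ lim1 lim2]) (use ev bounds in \<open>auto elim!: eventually_mono\<close>)
  ultimately have "(real k + 1) * I = pi" by (simp add: add.commute)
  then show ?thesis unfolding I_def[symmetric] by (simp add: field_simps)
qed

lemma ball_moment_diagonal:
  assumes "r > 0"
  shows "(LINT z|lebesgue_on (ball 0 r). z ^ k * cnj z ^ k) = of_real (r ^ (2*k+2) * pi / (real k + 1))"
proof -
  have eq: "z ^ k * cnj z ^ k = of_real (norm z ^ (2*k))" for z :: complex
  proof -
    have "complex_of_real (norm z ^ (2*k)) = (of_real ((norm z)\<^sup>2)) ^ k"
      by (simp add: power_mult)
    also have "\<dots> = z ^ k * cnj z ^ k"
      by (simp only: complex_norm_square power_mult_distrib)
    finally show ?thesis ..
  qed
  have "(LINT z|lebesgue_on (ball 0 r). z ^ k * cnj z ^ k)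
      = (LINT z|lborel. complex_of_real (indicator (ball 0 r) z * norm (z::complex) ^ (2*k)))"
    by (subst integral_lebesgue_on_ball)
       (auto simp: eq indicator_def scaleR_conv_of_real intro!: Bochner_Integration.integral_cong)
  also have "\<dots> = of_real (r ^ (2*k+2) * pi / (real k + 1))"
    by (subst integral_complex_of_real) (simp only: radial_moment_scale[OF assms] radial_moment times_divide_eq_right)
  finally show ?thesis .
qed

section \<open>The inner product on square integrable functions\<close>

lemma borel_measurable_cnj [measurable (raw)]:
  "f \<in> borel_measurable M \<Longrightarrow> (\<lambda>x. cnj (f x)) \<in> borel_measurable M"
  by (rule borel_measurable_continuous_on[of cnj]) (auto intro: continuous_intros)

lemma L2_discI:
  "f \<in> borel_measurable disc_area \<Longrightarrow> integrable disc_area (\<lambda>z. (norm (f z))\<^sup>2) \<Longrightarrow> f \<in> L2_disc"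
  by (simp add: L2_disc_def)

lemma L2_disc_measurable: "f \<in> L2_disc \<Longrightarrow> f \<in> borel_measurable disc_area"
  by (simp add: L2_disc_def)

lemma L2_disc_integrable: "f \<in> L2_disc \<Longrightarrow> integrable disc_area (\<lambda>z. (norm (f z))\<^sup>2)"
  by (simp add: L2_disc_def)

lemma integrable_L2_product:
  assumes "f \<in> L2_disc" "g \<in> L2_disc"
  shows "integrable disc_area (\<lambda>z. f z * cnj (g z))"
proof (rule Bochner_Integration.integrable_bound)
  show "integrable disc_area (\<lambda>z. (norm (f z))\<^sup>2 + (norm (g z))\<^sup>2)"
    using assms by (intro Bochner_Integration.integrable_add L2_disc_integrable)
  have [measurable]: "f \<in> borel_measurable disc_area" "g \<in> borel_measurable disc_area"
    using assms by (simp_all add: L2_disc_measurable)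
  show "(\<lambda>z. f z * cnj (g z)) \<in> borel_measurable disc_area"
    by measurable
  have "a * b \<le> a\<^sup>2 + b\<^sup>2" if "0 \<le> a" "0 \<le> b" for a b :: real
    using sum_squares_bound[of a b] that mult_nonneg_nonneg[of a b] by linarith
  then show "AE z in disc_area. norm (f z * cnj (g z)) \<le> norm ((norm (f z))\<^sup>2 + (norm (g z))\<^sup>2)"
    by (intro AE_I2) (simp add: norm_mult)
qed

lemma L2_disc_bounded_mult:
  assumes f: "f \<in> L2_disc" and p: "p \<in> borel_measurable disc_area"
    and C: "\<And>z. z \<in> ball 0 1 \<Longrightarrow> norm (p z) \<le> C"
  shows "(\<lambda>z. p z * f z) \<in> L2_disc"
proof (rule L2_discI)
  have [measurable]: "f \<in> borel_measurable disc_area" "p \<in> borel_measurable disc_area"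
    using f p by (simp_all add: L2_disc_measurable)
  show 1: "(\<lambda>z. p z * f z) \<in> borel_measurable disc_area" by measurable
  show "integrable disc_area (\<lambda>z. (norm (p z * f z))\<^sup>2)"
  proof (rule Bochner_Integration.integrable_bound)
    show "integrable disc_area (\<lambda>z. C\<^sup>2 * (norm (f z))\<^sup>2)"
      using f by (intro integrable_mult_right L2_disc_integrable)
    show "(\<lambda>z. (norm (p z * f z))\<^sup>2) \<in> borel_measurable disc_area" by measurable
    show "AE z in disc_area. norm ((norm (p z * f z))\<^sup>2) \<le> norm (C\<^sup>2 * (norm (f z))\<^sup>2)"
      using C by (intro AE_I2)
        (auto simp: norm_mult power_mult_distrib simp del: mem_ball intro!: mult_right_mono power_mono)
  qed
qed

lemma L2_disc_scale: "f \<in> L2_disc \<Longrightarrow> (\<lambda>z. c * f z) \<in> L2_disc"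
  by (rule L2_disc_bounded_mult[where C = "norm c"]) auto

lemma L2_disc_add:
  assumes "f \<in> L2_disc" "g \<in> L2_disc"
  shows "(\<lambda>z. f z + g z) \<in> L2_disc"
proof (rule L2_discI)
  have [measurable]: "f \<in> borel_measurable disc_area" "g \<in> borel_measurable disc_area"
    using assms by (simp_all add: L2_disc_measurable)
  show "(\<lambda>z. f z + g z) \<in> borel_measurable disc_area" by measurable
  show "integrable disc_area (\<lambda>z. (norm (f z + g z))\<^sup>2)"
  proof (rule Bochner_Integration.integrable_bound)
    show "integrable disc_area (\<lambda>z. 2 * (norm (f z))\<^sup>2 + 2 * (norm (g z))\<^sup>2)"
      using assms by (intro Bochner_Integration.integrable_add integrable_mult_right L2_disc_integrable)
    show "(\<lambda>z. (norm (f z + g z))\<^sup>2) \<in> borel_measurable disc_area" by measurable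
    have "(norm (a + b))\<^sup>2 \<le> 2 * (norm a)\<^sup>2 + 2 * (norm b)\<^sup>2" for a b :: complex
    proof -
      have "(norm (a + b))\<^sup>2 \<le> (norm a + norm b)\<^sup>2"
        by (intro power_mono norm_triangle_ineq) simp
      also have "\<dots> \<le> 2 * (norm a)\<^sup>2 + 2 * (norm b)\<^sup>2"
        using sum_squares_bound[of "norm a" "norm b"] by (simp add: power2_sum)
      finally show ?thesis .
    qed
    then show "AE z in disc_area. norm ((norm (f z + g z))\<^sup>2) \<le> norm (2 * (norm (f z))\<^sup>2 + 2 * (norm (g z))\<^sup>2)"
      by (intro AE_I2) simp
  qed
qed

lemma L2_disc_diff:
  assumes "f \<in> L2_disc" "g \<in> L2_disc"
  shows "(\<lambda>z. f z - g z) \<in> L2_disc"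
  using L2_disc_add[OF assms(1) L2_disc_scale[OF assms(2), of "-1"]] by simp

lemma L2_disc_zero: "(\<lambda>z. 0) \<in> L2_disc"
  by (simp add: L2_disc_def)

lemma L2_disc_sum:
  assumes "\<And>i. i \<in> I \<Longrightarrow> f i \<in> L2_disc"
  shows "(\<lambda>z. \<Sum>i\<in>I. f i z) \<in> L2_disc"
  using assms by (induction I rule: infinite_finite_induct) (auto simp: L2_disc_zero L2_disc_add)

lemma L2_inner_commute: "L2_inner g f = cnj (L2_inner f g)"
  unfolding L2_inner_def Bochner_Integration.integral_cnj[symmetric] by (simp add: mult.commute)

lemma L2_inner_add_left:
  "f \<in> L2_disc \<Longrightarrow> g \<in> L2_disc \<Longrightarrow> h \<in> L2_disc \<Longrightarrow>
   L2_inner (\<lambda>z. f z + g z) h = L2_inner f h + L2_inner g h"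
  unfolding L2_inner_def by (simp add: ring_distribs integrable_L2_product)

lemma L2_inner_scale_left: "L2_inner (\<lambda>z. c * f z) h = c * L2_inner f h"
  unfolding L2_inner_def by (simp add: mult.assoc)

lemma L2_inner_diff_left:
  "f \<in> L2_disc \<Longrightarrow> g \<in> L2_disc \<Longrightarrow> h \<in> L2_disc \<Longrightarrow>
   L2_inner (\<lambda>z. f z - g z) h = L2_inner f h - L2_inner g h"
  unfolding L2_inner_def by (simp add: ring_distribs integrable_L2_product)

lemma L2_inner_sum_left:
  assumes "\<And>i. i \<in> I \<Longrightarrow> f i \<in> L2_disc" "h \<in> L2_disc"
  shows "L2_inner (\<lambda>z. \<Sum>i\<in>I. f i z) h = (\<Sum>i\<in>I. L2_inner (f i) h)"
  using assms
proof (induction I rule: infinite_finite_induct)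
  case (insert i I)
  then show ?case by (simp add: L2_inner_add_left L2_disc_sum)
qed (auto simp: L2_inner_def)

lemma L2_inner_add_right:
  "f \<in> L2_disc \<Longrightarrow> g \<in> L2_disc \<Longrightarrow> h \<in> L2_disc \<Longrightarrow>
   L2_inner h (\<lambda>z. f z + g z) = L2_inner h f + L2_inner h g"
  unfolding L2_inner_commute[of h] by (simp add: L2_inner_add_left)

lemma L2_inner_diff_right:
  "f \<in> L2_disc \<Longrightarrow> g \<in> L2_disc \<Longrightarrow> h \<in> L2_disc \<Longrightarrow>
   L2_inner h (\<lambda>z. f z - g z) = L2_inner h f - L2_inner h g"
  unfolding L2_inner_commute[of h] by (simp add: L2_inner_diff_left)

lemma L2_inner_scale_right: "L2_inner h (\<lambda>z. c * f z) = cnj c * L2_inner h f"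
  unfolding L2_inner_commute[of h] by (simp add: L2_inner_scale_left)

lemma L2_inner_sum_right:
  assumes "\<And>i. i \<in> I \<Longrightarrow> f i \<in> L2_disc" "h \<in> L2_disc"
  shows "L2_inner h (\<lambda>z. \<Sum>i\<in>I. f i z) = (\<Sum>i\<in>I. L2_inner h (f i))"
proof -
  have "L2_inner h (\<lambda>z. \<Sum>i\<in>I. f i z) = cnj (L2_inner (\<lambda>z. \<Sum>i\<in>I. f i z) h)"
    by (rule L2_inner_commute)
  also have "\<dots> = (\<Sum>i\<in>I. cnj (L2_inner (f i) h))"
    by (simp only: L2_inner_sum_left[OF assms] cnj_sum)
  also have "\<dots> = (\<Sum>i\<in>I. L2_inner h (f i))"
    by (simp only: L2_inner_commute[of h, symmetric])
  finally show ?thesis .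
qed

lemma L2_inner_cong:
  assumes "\<And>z. z \<in> ball 0 1 \<Longrightarrow> f z = f' z" "\<And>z. z \<in> ball 0 1 \<Longrightarrow> g z = g' z"
  shows "L2_inner f g = L2_inner f' g'"
  unfolding L2_inner_def using assms by (intro Bochner_Integration.integral_cong) auto

lemma L2_inner_mult_left: "L2_inner (\<lambda>z. p z * f z) g = L2_inner f (\<lambda>z. cnj (p z) * g z)"
  by (simp add: L2_inner_def mult_ac)

lemma L2_norm_nonneg: "L2_norm f \<ge> 0"
  by (simp add: L2_norm_def)

lemma L2_norm_power2: "(L2_norm f)\<^sup>2 = (LINT z|disc_area. (norm (f z))\<^sup>2)"
  by (simp add: L2_norm_def)

lemma L2_inner_self: "L2_inner f f = of_real ((L2_norm f)\<^sup>2)"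
  unfolding L2_norm_power2 L2_inner_def
  by (subst integral_complex_of_real[symmetric]) (simp only: complex_norm_square)

lemma L2_Cauchy_Schwarz:
  assumes "f \<in> L2_disc" "g \<in> L2_disc"
  shows "norm (L2_inner f g) \<le> L2_norm f * L2_norm g"
proof -
  have [measurable]: "f \<in> borel_measurable disc_area" "g \<in> borel_measurable disc_area"
    using assms by (simp_all add: L2_disc_measurable)
  define X where "X = (LINT z|disc_area. norm (f z) * norm (g z))"
  have X0: "X \<ge> 0" unfolding X_def by simp
  have int: "integrable disc_area (\<lambda>z. norm (f z) * norm (g z))"
    using integrable_norm[OF integrable_L2_product[OF assms]] by (simp add: norm_mult)
  have nn: "(\<integral>\<^sup>+z. (ennreal (norm (h z)))\<^sup>2 \<partial>disc_area) = ennreal ((L2_norm h)\<^sup>2)"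
    if "h \<in> L2_disc" for h
    unfolding L2_norm_power2
    using nn_integral_eq_integral[OF L2_disc_integrable[OF that]] by (simp add: ennreal_power)
  have "(\<integral>\<^sup>+z. ennreal (norm (f z)) * ennreal (norm (g z)) \<partial>disc_area) = ennreal X"
    unfolding X_def using nn_integral_eq_integral[OF int] by (simp add: ennreal_mult)
  then have "ennreal X ^ 2 \<le> ennreal ((L2_norm f)\<^sup>2) * ennreal ((L2_norm g)\<^sup>2)"
    using Cauchy_Schwarz_nn_integral[of "\<lambda>z. ennreal (norm (f z))" disc_area "\<lambda>z. ennreal (norm (g z))"] assms
    by (simp add: nn)
  then have "X\<^sup>2 \<le> (L2_norm f * L2_norm g)\<^sup>2"
    using X0 by (simp add: ennreal_power flip: ennreal_mult) (simp add: power_mult_distrib)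
  then have "X \<le> L2_norm f * L2_norm g"
    by (rule power2_le_imp_le) (simp add: L2_norm_nonneg)
  moreover have "norm (L2_inner f g) \<le> X"
    unfolding L2_inner_def X_def using integral_norm_bound[of disc_area "\<lambda>z. f z * cnj (g z)"]
    by (simp add: norm_mult)
  ultimately show ?thesis by simp
qed

lemma measurable_continuous_on_disc: "continuous_on (ball 0 1) f \<Longrightarrow> f \<in> borel_measurable disc_area"
  by (rule continuous_imp_measurable_on_sets_lebesgue) simp_all

lemma L2_disc_bounded:
  assumes "f \<in> borel_measurable disc_area" "\<And>z. z \<in> ball 0 1 \<Longrightarrow> norm (f z) \<le> C"
  shows "f \<in> L2_disc"
proof -
  have "(\<lambda>z. 1) \<in> L2_disc"
    by (simp add: L2_disc_def finite_measure.integrable_const finite_measure_lebesgue_on)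
  from L2_disc_bounded_mult[OF this assms] show ?thesis by simp
qed

lemma L2_disc_monomial: "(\<lambda>z. z ^ a * cnj z ^ b) \<in> L2_disc"
  by (rule L2_disc_bounded[where C = 1])
     (auto intro!: measurable_continuous_on_disc continuous_intros mult_le_one power_le_one
           simp: norm_mult norm_power)

lemma L2_disc_power: "(\<lambda>z. z ^ k) \<in> L2_disc"
  using L2_disc_monomial[of k 0] by simp

text \<open>Among the powers of \<open>z\<close>, at most one is not orthogonal to a given monomial in \<open>z\<close> and
  \<open>cnj z\<close>. This is why Toeplitz operators with monomial symbols are weighted shifts.\<close>

lemma L2_inner_monomial_power:
  "L2_inner (\<lambda>z. z ^ a * cnj z ^ b) (\<lambda>z. z ^ m) =
     (if a = b + m then of_real (pi / (real a + 1)) else 0)"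
proof -
  have eq: "L2_inner (\<lambda>z. z ^ a * cnj z ^ b) (\<lambda>z. z ^ m) = (LINT z|disc_area. z ^ a * cnj z ^ (b + m))"
    by (simp add: L2_inner_def power_add mult.assoc)
  show ?thesis
  proof (cases "a = b + m")
    case True
    have "(LINT z|disc_area. z ^ a * cnj z ^ (b + m)) = (LINT z|disc_area. z ^ a * cnj z ^ a)"
      by (simp only: True)
    also have "\<dots> = of_real (pi / (real a + 1))"
      by (simp only: ball_moment_diagonal[OF zero_less_one] power_one mult_1)
    finally show ?thesis
      using eq by (simp only: if_P[OF True])
  next
    case False
    then show ?thesis
      using eq ball_moment_offdiagonal[of a "b + m" 1] by simp
  qed
qed

lemma L2_inner_power_power:
  "L2_inner (\<lambda>z. z ^ a) (\<lambda>z. z ^ m) = (if a = m then of_real (pi / (real a + 1)) else 0)"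
  using L2_inner_monomial_power[of a 0 m] by simp

section \<open>Orthogonal expansion in the Bergman space\<close>

lemma L2_disc_polynomial: "(\<lambda>z. \<Sum>k\<in>K. a k * z ^ k) \<in> L2_disc"
  by (intro L2_disc_sum L2_disc_scale L2_disc_power)

lemma L2_inner_polynomial_right:
  assumes "g \<in> L2_disc"
  shows "L2_inner g (\<lambda>z. \<Sum>k\<in>K. a k * z ^ k) = (\<Sum>k\<in>K. cnj (a k) * L2_inner g (\<lambda>z. z ^ k))"
  using assms
  by (simp add: L2_inner_sum_right[OF L2_disc_scale[OF L2_disc_power]] L2_inner_scale_right)

lemma L2_inner_polynomial_power:
  assumes "finite K"
  shows "L2_inner (\<lambda>z. \<Sum>k\<in>K. a k * z ^ k) (\<lambda>z. z ^ m)
       = (if m \<in> K then of_real (pi / (real m + 1)) * a m else 0)"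
proof -
  have "L2_inner (\<lambda>z. \<Sum>k\<in>K. a k * z ^ k) (\<lambda>z. z ^ m)
      = (\<Sum>k\<in>K. if k = m then of_real (pi / (real m + 1)) * a m else 0)"
    by (subst L2_inner_sum_left[OF L2_disc_scale[OF L2_disc_power] L2_disc_power],
        rule sum.cong, simp, unfold L2_inner_scale_left L2_inner_power_power, simp)
  then show ?thesis using assms by (simp add: sum.delta)
qed

lemma L2_norm_polynomial:
  assumes "finite K"
  shows "(L2_norm (\<lambda>z. \<Sum>k\<in>K. a k * z ^ k))\<^sup>2 = (\<Sum>k\<in>K. pi / (real k + 1) * (norm (a k))\<^sup>2)"
proof -
  let ?p = "\<lambda>z. \<Sum>k\<in>K. a k * z ^ k"
  have "of_real ((L2_norm ?p)\<^sup>2) = (\<Sum>k\<in>K. cnj (a k) * L2_inner ?p (\<lambda>z. z ^ k))"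
    unfolding L2_inner_self[symmetric] by (rule L2_inner_polynomial_right[OF L2_disc_polynomial])
  also have "\<dots> = (\<Sum>k\<in>K. of_real (pi / (real k + 1) * (norm (a k))\<^sup>2))"
  proof (rule sum.cong[OF refl])
    fix k assume "k \<in> K"
    then have "cnj (a k) * L2_inner ?p (\<lambda>z. z ^ k) = of_real (pi / (real k + 1)) * (a k * cnj (a k))"
      using L2_inner_polynomial_power[OF assms, of a k] by simp
    then show "cnj (a k) * L2_inner ?p (\<lambda>z. z ^ k) = of_real (pi / (real k + 1) * (norm (a k))\<^sup>2)"
      by (simp only: of_real_mult complex_norm_square)
  qed
  finally show ?thesis
    by (simp only: of_real_sum[symmetric] of_real_eq_iff)
qed

text \<open>The powers of \<open>z\<close> are orthogonal but not normalised; the factor is the inverse of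
  \<open>(norm of z\<^sup>k)\<^sup>2 = pi / (k + 1)\<close>, so that for Bergman functions these are the Taylor
  coefficients at the origin.\<close>

definition monomial_coeff :: "(complex \<Rightarrow> complex) \<Rightarrow> nat \<Rightarrow> complex" where
  "monomial_coeff g k = of_real ((real k + 1) / pi) * L2_inner g (\<lambda>z. z ^ k)"

lemma L2_inner_power_eq_coeff:
  "L2_inner g (\<lambda>z. z ^ k) = of_real (pi / (real k + 1)) * monomial_coeff g k"
proof -
  have "pi / (real k + 1) * ((real k + 1) / pi) = 1"
    by (simp add: add_pos_nonneg[THEN less_imp_neq, symmetric] add_nonneg_pos[THEN less_imp_neq, symmetric])
  then show ?thesis
    unfolding monomial_coeff_def mult.assoc[symmetric] of_real_mult[symmetric] by simp
qed

text \<open>The weights \<open>pi / (k + 1)\<close> are the squared norms of the powers of \<open>z\<close>; thus this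
  weighted sequence space is a model of the Bergman space.\<close>

definition square_summable :: "(nat \<Rightarrow> complex) \<Rightarrow> bool" where
  "square_summable a \<longleftrightarrow> summable (\<lambda>k. pi / (real k + 1) * (norm (a k))\<^sup>2)"

text \<open>For the partial expansion \<open>p\<close> of \<open>g\<close>, both \<open>L2_inner g p\<close> and the square of the norm of
  \<open>p\<close> are the left-hand side, so Cauchy--Schwarz for the pair \<open>g\<close>, \<open>p\<close> is the claim.\<close>

lemma Bessel_inequality:
  assumes g: "g \<in> L2_disc" and K: "finite K"
  shows "(\<Sum>k\<in>K. pi / (real k + 1) * (norm (monomial_coeff g k))\<^sup>2) \<le> (L2_norm g)\<^sup>2"
proof -
  define p where "p = (\<lambda>z. \<Sum>k\<in>K. monomial_coeff g k * z ^ k)"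
  have p: "p \<in> L2_disc" unfolding p_def by (rule L2_disc_polynomial)
  have np: "(L2_norm p)\<^sup>2 = (\<Sum>k\<in>K. pi / (real k + 1) * (norm (monomial_coeff g k))\<^sup>2)"
    unfolding p_def by (rule L2_norm_polynomial[OF K])
  have "L2_inner g p = (\<Sum>k\<in>K. of_real (pi / (real k + 1)) * (monomial_coeff g k * cnj (monomial_coeff g k)))"
    unfolding p_def L2_inner_polynomial_right[OF g] L2_inner_power_eq_coeff by (simp add: mult_ac)
  also have "\<dots> = of_real ((L2_norm p)\<^sup>2)"
    unfolding np by (simp only: of_real_sum of_real_mult complex_norm_square)
  finally have "(L2_norm p)\<^sup>2 \<le> L2_norm g * L2_norm p"
    using L2_Cauchy_Schwarz[OF g p] by (simp add: norm_power)
  then have "L2_norm p \<le> L2_norm g"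
    using L2_norm_nonneg[of p] L2_norm_nonneg[of g]
    by (cases "L2_norm p = 0") (auto simp: power2_eq_square)
  then show ?thesis
    unfolding np[symmetric] by (intro power_mono L2_norm_nonneg)
qed

lemma square_summable_coeff: "g \<in> L2_disc \<Longrightarrow> square_summable (monomial_coeff g)"
  unfolding square_summable_def
  by (rule summableI_nonneg_bounded[where x = "(L2_norm g)\<^sup>2"]) (simp, rule Bessel_inequality, auto)

text \<open>By \<open>x * y \<le> x\<^sup>2 + y\<^sup>2\<close>, with the factor \<open>sqrt (k + 1)\<close> moved from one factor to the other, a
  term is at most a summand of the weighted norm plus a summand of the derivative of a
  geometric series.\<close>

lemma summable_square_summable_power:
  assumes a: "square_summable a" and z: "norm (z::complex) < 1"
  shows "summable (\<lambda>k. norm (a k * z ^ k))"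
proof (rule summable_comparison_test)
  have z2: "norm ((norm z)\<^sup>2) < 1"
    using z by (simp add: abs_square_less_1)
  have "summable (\<lambda>k. of_nat (Suc k) * ((norm z)\<^sup>2) ^ k)"
    using geometric_deriv_sums[OF z2] by (rule sums_summable)
  moreover have "summable (\<lambda>k. 1 / pi * (pi / (real k + 1) * (norm (a k))\<^sup>2))"
    using a unfolding square_summable_def by (rule summable_mult)
  ultimately show "summable (\<lambda>k. 1 / pi * (pi / (real k + 1) * (norm (a k))\<^sup>2) + of_nat (Suc k) * ((norm z)\<^sup>2) ^ k)"
    by (rule summable_add[rotated])
  have "norm (a k) * norm z ^ k \<le> (norm (a k))\<^sup>2 / (real k + 1) + (real k + 1) * ((norm z)\<^sup>2) ^ k" for k
  proof -
    define t where "t = sqrt (real k + 1)"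
    have t: "t > 0" "t\<^sup>2 = real k + 1" by (simp_all add: t_def add_pos_nonneg)
    have xy: "x * y \<le> x\<^sup>2 + y\<^sup>2" if "x \<ge> 0" "y \<ge> 0" for x y :: real
      using sum_squares_bound[of x y] mult_nonneg_nonneg[OF that] by linarith
    have "norm (a k) * norm z ^ k = (norm (a k) / t) * (t * norm z ^ k)"
      using t by simp
    also have "\<dots> \<le> (norm (a k) / t)\<^sup>2 + (t * norm z ^ k)\<^sup>2"
      using t by (intro xy) auto
    also have "\<dots> = (norm (a k))\<^sup>2 / (real k + 1) + (real k + 1) * ((norm z)\<^sup>2) ^ k"
      using t(2) by (simp add: power_divide power_mult_distrib power_mult[symmetric] mult.commute)
    finally show ?thesis .
  qed
  then show "\<exists>N. \<forall>k\<ge>N. norm (norm (a k * z ^ k))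
      \<le> 1 / pi * (pi / (real k + 1) * (norm (a k))\<^sup>2) + of_nat (Suc k) * ((norm z)\<^sup>2) ^ k"
    by (auto simp: norm_mult norm_power add.commute)
qed

definition disc_series :: "(nat \<Rightarrow> complex) \<Rightarrow> complex \<Rightarrow> complex" where
  "disc_series a z = (if z \<in> ball 0 1 then \<Sum>k. a k * z ^ k else 0)"

lemma disc_series_sums:
  assumes "square_summable a" "z \<in> ball 0 1"
  shows "(\<lambda>k. a k * z ^ k) sums disc_series a z"
  using summable_square_summable_power[OF assms(1), of z] assms(2)
  by (auto simp: disc_series_def dest: summable_norm_cancel intro: summable_sums)

lemma disc_series_holomorphic:
  assumes "square_summable a"
  shows "disc_series a holomorphic_on ball 0 1"
  using disc_series_sums[OF assms] by (intro power_series_holomorphic[where a = a]) simp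

text \<open>Fatou's lemma, applied to the finite sections of the tail, whose norms are known by
  orthogonality, bounds the norm of the whole tail. The case \<open>N = 0\<close> shows square integrability of the
  sum; letting \<open>N\<close> grow shows convergence in the mean.\<close>

lemma disc_series_tail:
  fixes a :: "nat \<Rightarrow> complex" and N :: nat
  assumes a: "square_summable a"
  defines "d \<equiv> (\<lambda>z. disc_series a z - (\<Sum>k<N. a k * z ^ k))"
  shows "d \<in> L2_disc" "(L2_norm d)\<^sup>2 \<le> (\<Sum>k. pi / (real (k + N) + 1) * (norm (a (k + N)))\<^sup>2)"
proof -
  define b where "b k = pi / (real k + 1) * (norm (a k))\<^sup>2" for k
  define t where "t = (\<Sum>k. b (k + N))"
  have b0: "b k \<ge> 0" for k by (simp add: b_def)
  have sb: "summable (\<lambda>k. b (k + N))"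
    using a unfolding square_summable_def b_def by (subst summable_iff_shift)
  define q where "q M z = (\<Sum>k\<in>{N..<M+N}. a k * z ^ k)" for M z
  have qL: "q M \<in> L2_disc" for M
    unfolding q_def[abs_def] by (rule L2_disc_polynomial)
  have [measurable]: "q M \<in> borel_measurable disc_area" for M
    using qL by (rule L2_disc_measurable)
  have dm[measurable]: "d \<in> borel_measurable disc_area"
    unfolding d_def
    by (intro measurable_continuous_on_disc continuous_intros
        holomorphic_on_imp_continuous_on disc_series_holomorphic a)
  have qd: "(\<lambda>M. q M z) \<longlonglongrightarrow> d z" if "z \<in> ball 0 1" for z
  proof -
    have "(\<lambda>M. \<Sum>k<M + N. a k * z ^ k) \<longlonglongrightarrow> disc_series a z"
      using disc_series_sums[OF a that] unfolding sums_def by (rule LIMSEQ_ignore_initial_segment)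
    then have "(\<lambda>M. (\<Sum>k<M + N. a k * z ^ k) - (\<Sum>k<N. a k * z ^ k)) \<longlonglongrightarrow> d z"
      unfolding d_def by (intro tendsto_intros)
    moreover have "(\<Sum>k<M + N. a k * z ^ k) - (\<Sum>k<N. a k * z ^ k) = q M z" for M
      using sum_diff_nat_ivl[of 0 N "M + N" "\<lambda>k. a k * z ^ k"] by (simp add: q_def atLeast0LessThan)
    ultimately show ?thesis by simp
  qed
  have qn: "(\<integral>\<^sup>+z. ennreal ((norm (q M z))\<^sup>2) \<partial>disc_area) \<le> ennreal t" for M
  proof -
    have "(\<integral>\<^sup>+z. ennreal ((norm (q M z))\<^sup>2) \<partial>disc_area) = ennreal ((L2_norm (q M))\<^sup>2)"
      unfolding L2_norm_power2 by (rule nn_integral_eq_integral[OF L2_disc_integrable[OF qL]]) simp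
    also have "(L2_norm (q M))\<^sup>2 = (\<Sum>k\<in>{N..<M+N}. b k)"
      unfolding q_def[abs_def] b_def by (rule L2_norm_polynomial) simp
    also have "\<dots> = (\<Sum>k<M. b (k + N))"
      using sum.shift_bounds_nat_ivl[of b 0 N M] by (simp add: atLeast0LessThan)
    also have "ennreal \<dots> \<le> ennreal t"
      unfolding t_def by (intro ennreal_leI sum_le_suminf sb) (auto simp: b0)
    finally show ?thesis .
  qed
  have "(\<integral>\<^sup>+z. ennreal ((norm (d z))\<^sup>2) \<partial>disc_area)
      = (\<integral>\<^sup>+z. liminf (\<lambda>M. ennreal ((norm (q M z))\<^sup>2)) \<partial>disc_area)"
    using qd by (intro nn_integral_cong lim_imp_Liminf[symmetric]) (auto intro!: tendsto_intros)
  also have "\<dots> \<le> liminf (\<lambda>M. \<integral>\<^sup>+z. ennreal ((norm (q M z))\<^sup>2) \<partial>disc_area)"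
    by (intro nn_integral_liminf) measurable
  also have "\<dots> \<le> liminf (\<lambda>M::nat. ennreal t)"
    by (intro Liminf_mono) (simp add: qn)
  also have "\<dots> = ennreal t"
    by (simp add: Liminf_const)
  finally have le: "(\<integral>\<^sup>+z. ennreal ((norm (d z))\<^sup>2) \<partial>disc_area) \<le> ennreal t" .
  then have "integrable disc_area (\<lambda>z. (norm (d z))\<^sup>2)"
    by (intro integrableI_nonneg) (auto intro: le_less_trans)
  with dm show dL: "d \<in> L2_disc" by (rule L2_discI)
  have "ennreal ((L2_norm d)\<^sup>2) \<le> ennreal t"
    using le nn_integral_eq_integral[OF L2_disc_integrable[OF dL]] by (simp add: L2_norm_power2)
  moreover have "t \<ge> 0" unfolding t_def by (intro suminf_nonneg sb b0)
  ultimately have "(L2_norm d)\<^sup>2 \<le> t" by (simp add: ennreal_le_iff)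
  then show "(L2_norm d)\<^sup>2 \<le> (\<Sum>k. pi / (real (k + N) + 1) * (norm (a (k + N)))\<^sup>2)"
    by (simp add: t_def b_def)
qed

lemma disc_series_in_bergman:
  assumes "square_summable a"
  shows "disc_series a \<in> bergman_space"
  using disc_series_tail(1)[OF assms, of 0] disc_series_holomorphic[OF assms]
  by (simp add: bergman_space_def) (simp add: disc_series_def)

lemma L2_inner_disc_series:
  assumes a: "square_summable a" and g: "g \<in> L2_disc"
  shows "(\<lambda>k. cnj (a k) * L2_inner g (\<lambda>z. z ^ k)) sums L2_inner g (disc_series a)"
proof -
  define p where "p N = (\<lambda>z. \<Sum>k<N. a k * z ^ k)" for N
  define d where "d N = (\<lambda>z. disc_series a z - p N z)" for N
  define t where "t N = (\<Sum>k. pi / (real (k + N) + 1) * (norm (a (k + N)))\<^sup>2)" for N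
  have S: "disc_series a \<in> L2_disc"
    using disc_series_in_bergman[OF a] by (simp add: bergman_space_def)
  have p: "p N \<in> L2_disc" for N unfolding p_def by (rule L2_disc_polynomial)
  have d: "d N \<in> L2_disc" "(L2_norm (d N))\<^sup>2 \<le> t N" for N
    unfolding d_def p_def t_def using disc_series_tail[OF a] by blast+
  have t0: "t \<longlonglongrightarrow> 0"
    unfolding t_def using suminf_exist_split2[OF a[unfolded square_summable_def]] by simp
  have "(\<lambda>N. L2_inner g (disc_series a) - L2_inner g (p N)) \<longlonglongrightarrow> 0"
  proof (rule Lim_null_comparison)
    show "\<forall>\<^sub>F N in sequentially. norm (L2_inner g (disc_series a) - L2_inner g (p N)) \<le> L2_norm g * sqrt (t N)"
    proof (intro always_eventually allI)
      fix N
      have "L2_inner g (disc_series a) - L2_inner g (p N) = L2_inner g (d N)"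
        unfolding d_def by (rule L2_inner_diff_right[symmetric, OF S p g])
      also have "norm \<dots> \<le> L2_norm g * L2_norm (d N)"
        by (rule L2_Cauchy_Schwarz[OF g d(1)])
      also have "\<dots> \<le> L2_norm g * sqrt (t N)"
        using d(2)[of N] by (intro mult_left_mono L2_norm_nonneg real_le_rsqrt)
      finally show "norm (L2_inner g (disc_series a) - L2_inner g (p N)) \<le> L2_norm g * sqrt (t N)" .
    qed
    show "(\<lambda>N. L2_norm g * sqrt (t N)) \<longlonglongrightarrow> 0"
      using tendsto_mult_left[OF tendsto_real_sqrt[OF t0], of "L2_norm g"] by simp
  qed
  from tendsto_diff[OF tendsto_const[of "L2_inner g (disc_series a)"] this]
  have "(\<lambda>N. L2_inner g (p N)) \<longlonglongrightarrow> L2_inner g (disc_series a)"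
    by simp
  then show ?thesis
    unfolding sums_def p_def L2_inner_polynomial_right[OF g] .
qed

lemma monomial_coeff_disc_series:
  assumes a: "square_summable a"
  shows "monomial_coeff (disc_series a) = a"
proof
  fix m
  have "(\<lambda>k. cnj (a k) * L2_inner (\<lambda>z. z ^ m) (\<lambda>z. z ^ k)) sums L2_inner (\<lambda>z. z ^ m) (disc_series a)"
    by (rule L2_inner_disc_series[OF a L2_disc_power])
  moreover have "(\<lambda>k. cnj (a k) * L2_inner (\<lambda>z. z ^ m) (\<lambda>z. z ^ k))
      = (\<lambda>k. if k = m then cnj (a k) * of_real (pi / (real m + 1)) else 0)"
    by (auto simp: L2_inner_power_power)
  ultimately have "L2_inner (\<lambda>z. z ^ m) (disc_series a) = cnj (a m) * of_real (pi / (real m + 1))"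
    using sums_single[of m "\<lambda>k. cnj (a k) * of_real (pi / (real m + 1))"] sums_unique2 by metis
  then have "L2_inner (disc_series a) (\<lambda>z. z ^ m) = of_real (pi / (real m + 1)) * a m"
    by (subst L2_inner_commute) simp
  then have "of_real (pi / (real m + 1)) * monomial_coeff (disc_series a) m = of_real (pi / (real m + 1)) * a m"
    by (simp only: L2_inner_power_eq_coeff)
  moreover have "pi / (real m + 1) \<noteq> 0"
    by (simp add: add_eq_0_iff)
  ultimately show "monomial_coeff (disc_series a) m = a m"
    by (simp only: mult_cancel_left of_real_eq_0_iff) simp
qed

section \<open>Completeness of the monomials and the Bergman projection\<close>

lemma bergman_L2: "h \<in> bergman_space \<Longrightarrow> h \<in> L2_disc"
  by (simp add: bergman_space_def)

lemma bergman_outside: "h \<in> bergman_space \<Longrightarrow> z \<notin> ball 0 1 \<Longrightarrow> h z = 0"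
  by (simp add: bergman_space_def)

text \<open>On a strictly smaller ball the series converges absolutely with a uniform geometric bound, so it
  may be integrated termwise, and orthogonality leaves only the term with index \<open>k\<close>.\<close>

lemma integral_power_series_ball:
  fixes c :: "nat \<Rightarrow> complex"
  assumes r: "0 < r" "r < 1"
    and c: "\<And>z. z \<in> ball 0 1 \<Longrightarrow> (\<lambda>i. c i * z ^ i) sums h z"
  shows "(LINT z|lebesgue_on (ball 0 r). h z * cnj z ^ k) = c k * of_real (r ^ (2*k+2) * pi / (real k + 1))"
proof -
  let ?M = "lebesgue_on (ball (0::complex) r)"
  interpret finite_measure ?M by (simp add: finite_measure_lebesgue_on)
  let ?f = "\<lambda>i z. c i * (z ^ i * cnj z ^ k)"
  have meas: "(\<lambda>z::complex. z ^ i * cnj z ^ k) \<in> borel_measurable ?M" for i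
    by (intro continuous_imp_measurable_on_sets_lebesgue continuous_intros) simp
  have bd: "norm (?f i z) \<le> norm (c i) * r ^ i" if "z \<in> ball 0 r" for i z
  proof -
    have "norm z ^ i * norm z ^ k \<le> r ^ i * 1"
      using that r by (intro mult_mono power_mono power_le_one) auto
    then show ?thesis
      by (simp add: norm_mult norm_power mult_left_mono)
  qed
  have int: "integrable ?M (?f i)" for i
    using bd[of _ i]
    by (intro integrable_const_bound[where B = "norm (c i) * r ^ i"] AE_I2
        borel_measurable_times[OF borel_measurable_const meas]) auto
  \<comment> \<open>\<open>(r + 1) / 2\<close> is a point of convergence between \<open>r\<close> and \<open>1\<close>\<close>
  have "summable (\<lambda>i. norm (c i * of_real r ^ i))"
    using c[of "of_real ((r + 1) / 2)"] r
    by (intro powser_insidea[of c "of_real ((r + 1) / 2)"]) (auto simp: norm_divide dest: sums_summable simp flip: of_real_add)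
  then have sr: "summable (\<lambda>i. norm (c i) * r ^ i)"
    using r by (simp add: norm_mult norm_power)
  have "(\<lambda>i. integral\<^sup>L ?M (?f i)) sums (LINT z|?M. (\<Sum>i. ?f i z))"
  proof (rule sums_integral[OF int])
    show "AE z in ?M. summable (\<lambda>i. norm (?f i z))"
      using bd by (intro AE_I2 summable_comparison_test[OF _ sr]) auto
    have "norm (LINT z|?M. norm (?f i z)) \<le> (norm (c i) * r ^ i) * measure ?M (ball 0 r)" for i
    proof -
      have "(LINT z|?M. norm (?f i z)) \<le> (LINT z|?M. norm (c i) * r ^ i)"
        using bd[of _ i] by (intro integral_mono integrable_norm int) auto
      then show ?thesis by (simp add: mult_ac)
    qed
    then show "summable (\<lambda>i. LINT z|?M. norm (?f i z))"
      by (intro summable_comparison_test[OF _ summable_mult2[OF sr]]) blast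
  qed
  moreover have "(LINT z|?M. (\<Sum>i. ?f i z)) = (LINT z|?M. h z * cnj z ^ k)"
  proof (intro Bochner_Integration.integral_cong refl)
    fix z assume "z \<in> space ?M"
    then have "(\<lambda>i. c i * z ^ i * cnj z ^ k) sums (h z * cnj z ^ k)"
      using c[of z] r by (intro sums_mult2) auto
    then show "(\<Sum>i. ?f i z) = h z * cnj z ^ k"
      by (simp add: sums_iff mult.assoc)
  qed
  moreover have "integral\<^sup>L ?M (?f i) = (if i = k then c k * of_real (r ^ (2*k+2) * pi / (real k + 1)) else 0)" for i
  proof (cases "i = k")
    case True
    then show ?thesis
      unfolding integral_mult_right_zero using ball_moment_diagonal[OF r(1), of k] by simp
  next
    case False
    then show ?thesis
      unfolding integral_mult_right_zero using ball_moment_offdiagonal[OF False, of r] by simp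
  qed
  ultimately have "(\<lambda>i. if i = k then c k * of_real (r ^ (2*k+2) * pi / (real k + 1)) else 0)
      sums (LINT z|?M. h z * cnj z ^ k)"
    by simp
  then show ?thesis
    using sums_single[of k "\<lambda>_. c k * of_real (r ^ (2*k+2) * pi / (real k + 1))"] sums_unique2 by blast
qed

text \<open>The series of \<open>h\<close> need not converge uniformly on the whole disc. The coefficient is therefore
  computed on balls of radius \<open>r < 1\<close>, and then \<open>r\<close> tends to \<open>1\<close> by dominated convergence, as
  \<open>h\<close> times a power of \<open>cnj z\<close> is integrable.\<close>

lemma monomial_coeff_eq_Taylor:
  assumes h: "h \<in> bergman_space"
    and c: "\<And>z. z \<in> ball 0 1 \<Longrightarrow> (\<lambda>i. c i * z ^ i) sums h z"
  shows "monomial_coeff h = c"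
proof
  fix k
  define F where "F z = h z * cnj z ^ k" for z
  define r where "r n = 1 - inverse (real n + 2)" for n
  have r: "0 < r n" "r n < 1" for n
    by (simp_all add: r_def field_simps)
  have r1: "r \<longlonglongrightarrow> 1"
    unfolding r_def by real_asymp
  have Fi: "integrable disc_area F"
    using integrable_L2_product[OF bergman_L2[OF h] L2_disc_power[of k]] by (simp add: F_def[abs_def])
  have Fm: "F \<in> borel_measurable disc_area" using Fi by (rule borel_measurable_integrable)
  have restrict: "(LINT z|lebesgue_on (ball 0 s). F z) = (LINT z|disc_area. indicator (ball 0 s) z *\<^sub>R F z)"
    if "s < 1" for s
    using that by (subst (1 2) integral_restrict_space)
      (auto intro!: Bochner_Integration.integral_cong simp: indicator_def)
  have "(\<lambda>n. LINT z|disc_area. indicator (ball 0 (r n)) z *\<^sub>R F z) \<longlonglongrightarrow> (LINT z|disc_area. F z)"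
  proof (rule integral_dominated_convergence[where w = "\<lambda>z. norm (F z)"])
    show "F \<in> borel_measurable disc_area" by (rule Fm)
    show "(\<lambda>z. indicator (ball 0 (r n)) z *\<^sub>R F z) \<in> borel_measurable disc_area" for n
    proof (intro borel_measurable_scaleR Fm borel_measurable_indicator)
      show "ball 0 (r n) \<in> sets disc_area"
        using r(2)[of n] by (auto simp: sets_restrict_space image_iff intro!: bexI[of _ "ball 0 (r n)"])
    qed
    show "integrable disc_area (\<lambda>z. norm (F z))" using Fi by (rule integrable_norm)
    show "AE z in disc_area. (\<lambda>n. indicator (ball 0 (r n)) z *\<^sub>R F z) \<longlonglongrightarrow> F z"
    proof (intro AE_I2 tendsto_eventually)
      fix z :: complex assume "z \<in> space disc_area"
      then have "norm z < 1" by simp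
      with r1 have "eventually (\<lambda>n. norm z < r n) sequentially"
        by (rule order_tendstoD)
      then show "\<forall>\<^sub>F n in sequentially. indicator (ball 0 (r n)) z *\<^sub>R F z = F z"
        by eventually_elim simp
    qed
    show "AE z in disc_area. norm (indicator (ball 0 (r n)) z *\<^sub>R F z) \<le> norm (F z)" for n
      by (intro AE_I2) (auto simp: indicator_def)
  qed
  moreover have "(LINT z|disc_area. indicator (ball 0 (r n)) z *\<^sub>R F z) = c k * of_real (r n ^ (2*k+2) * pi / (real k + 1))" for n
    by (subst restrict[OF r(2), symmetric]) (unfold F_def, rule integral_power_series_ball[OF r c])
  ultimately have "(\<lambda>n. c k * of_real (r n ^ (2*k+2) * pi / (real k + 1))) \<longlonglongrightarrow> (LINT z|disc_area. F z)"
    by simp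
  moreover have "(\<lambda>n. c k * of_real (r n ^ (2*k+2) * pi / (real k + 1))) \<longlonglongrightarrow> c k * of_real (1 ^ (2*k+2) * pi / (real k + 1))"
    using r1 by (intro tendsto_intros) (auto simp: add_eq_0_iff)
  ultimately have "(LINT z|disc_area. F z) = c k * of_real (pi / (real k + 1))"
    using LIMSEQ_unique by fastforce
  then have "L2_inner h (\<lambda>z. z ^ k) = of_real (pi / (real k + 1)) * c k"
    by (simp add: L2_inner_def F_def mult.commute)
  then have "of_real (pi / (real k + 1)) * monomial_coeff h k = of_real (pi / (real k + 1)) * c k"
    by (simp only: L2_inner_power_eq_coeff)
  moreover have "pi / (real k + 1) \<noteq> 0"
    by (simp add: add_eq_0_iff)
  ultimately show "monomial_coeff h k = c k"
    by (simp only: mult_cancel_left of_real_eq_0_iff) simp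
qed

text \<open>Completeness of the monomials: a Bergman function is the sum of its Taylor series, and the
  Taylor coefficients are determined by inner products with the powers of \<open>z\<close>.\<close>

lemma bergman_expansion:
  assumes h: "h \<in> bergman_space"
  shows "disc_series (monomial_coeff h) = h"
proof
  fix z
  define c where "c i = (deriv ^^ i) h 0 / fact i" for i
  have sums: "(\<lambda>i. c i * z ^ i) sums h z" if "z \<in> ball 0 1" for z
    using holomorphic_power_series[of h 0 1 z] h that by (simp add: bergman_space_def c_def)
  have "monomial_coeff h = c"
    by (rule monomial_coeff_eq_Taylor[OF h sums])
  then show "disc_series (monomial_coeff h) z = h z"
    using sums[of z] bergman_outside[OF h, of z] by (auto simp: disc_series_def sums_iff)
qed

lemma bergman_eqI:
  assumes "h1 \<in> bergman_space" "h2 \<in> bergman_space"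
    and "\<And>k. L2_inner h1 (\<lambda>z. z ^ k) = L2_inner h2 (\<lambda>z. z ^ k)"
  shows "h1 = h2"
proof -
  have "monomial_coeff h1 = monomial_coeff h2"
    using assms(3) by (auto simp: monomial_coeff_def)
  then show ?thesis
    using bergman_expansion assms(1,2) by metis
qed

lemma L2_inner_bergman_sums:
  assumes "g \<in> L2_disc" "h \<in> bergman_space"
  shows "(\<lambda>k. cnj (monomial_coeff h k) * L2_inner g (\<lambda>z. z ^ k)) sums L2_inner g h"
  using L2_inner_disc_series[OF square_summable_coeff[OF bergman_L2[OF assms(2)]] assms(1)]
  by (simp only: bergman_expansion[OF assms(2)])

lemma Parseval_bergman:
  assumes "h \<in> bergman_space"
  shows "(\<lambda>k. pi / (real k + 1) * (norm (monomial_coeff h k))\<^sup>2) sums (L2_norm h)\<^sup>2"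
proof -
  have "cnj (monomial_coeff h k) * L2_inner h (\<lambda>z. z ^ k)
      = of_real (pi / (real k + 1)) * (monomial_coeff h k * cnj (monomial_coeff h k))" for k
    by (simp only: L2_inner_power_eq_coeff mult_ac)
  also have "\<dots> k = of_real (pi / (real k + 1) * (norm (monomial_coeff h k))\<^sup>2)" for k
    by (simp only: complex_norm_square of_real_mult)
  finally show ?thesis
    using L2_inner_bergman_sums[OF bergman_L2[OF assms] assms]
    by (simp only: L2_inner_self sums_of_real_iff)
qed

text \<open>Test elements for identities in the Bergman space, whose members vanish outside the disc.\<close>

definition disc_power :: "nat \<Rightarrow> complex \<Rightarrow> complex" where
  "disc_power k z = (if z \<in> ball 0 1 then z ^ k else 0)"

lemma disc_power_bergman: "disc_power k \<in> bergman_space"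
proof -
  have hol: "disc_power k holomorphic_on ball 0 1"
    by (rule holomorphic_transform[of "\<lambda>z. z ^ k"]) (auto simp: disc_power_def intro!: holomorphic_intros)
  have "disc_power k \<in> L2_disc"
    by (rule L2_disc_bounded[where C = 1])
       (auto intro!: measurable_continuous_on_disc holomorphic_on_imp_continuous_on hol power_le_one
         simp: disc_power_def norm_power)
  with hol show ?thesis by (auto simp: bergman_space_def disc_power_def)
qed

lemma L2_inner_disc_power: "L2_inner g (disc_power k) = L2_inner g (\<lambda>z. z ^ k)"
  by (rule L2_inner_cong) (auto simp: disc_power_def)

lemma bergman_add:
  "f \<in> bergman_space \<Longrightarrow> g \<in> bergman_space \<Longrightarrow> (\<lambda>z. f z + g z) \<in> bergman_space"
  by (auto simp: bergman_space_def L2_disc_add intro: holomorphic_intros)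

lemma bergman_scale: "f \<in> bergman_space \<Longrightarrow> (\<lambda>z. c * f z) \<in> bergman_space"
  by (auto simp: bergman_space_def L2_disc_scale intro: holomorphic_intros)

text \<open>The projection keeps the monomial coefficients of \<open>g\<close> and sums the resulting series. The
  difference is orthogonal to all powers of \<open>z\<close>, hence to every Bergman function by the
  expansion of the latter.\<close>

lemma bergman_projection_eq:
  assumes g: "g \<in> L2_disc"
  shows "bergman_projection g = disc_series (monomial_coeff g)"
  unfolding bergman_projection_def
proof (rule the_equality)
  let ?h = "disc_series (monomial_coeff g)"
  have ss: "square_summable (monomial_coeff g)" using g by (rule square_summable_coeff)
  have h: "?h \<in> bergman_space" using ss by (rule disc_series_in_bergman)
  have hk: "L2_inner ?h (\<lambda>z. z ^ k) = L2_inner g (\<lambda>z. z ^ k)" for k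
    by (simp only: L2_inner_power_eq_coeff monomial_coeff_disc_series[OF ss])
  have gh: "(\<lambda>z. g z - ?h z) \<in> L2_disc" using g bergman_L2[OF h] by (rule L2_disc_diff)
  have 0: "L2_inner (\<lambda>z. g z - ?h z) (\<lambda>z. z ^ k) = 0" for k
    using hk by (simp add: L2_inner_diff_left g bergman_L2[OF h] L2_disc_power)
  have "L2_inner (\<lambda>z. g z - ?h z) k = 0" if "k \<in> bergman_space" for k
    using L2_inner_bergman_sums[OF gh that] by (simp add: 0 sums_iff)
  with h show "?h \<in> bergman_space \<and> (\<forall>k\<in>bergman_space. L2_inner (\<lambda>z. g z - ?h z) k = 0)"
    by blast
  fix h' assume h': "h' \<in> bergman_space \<and> (\<forall>k\<in>bergman_space. L2_inner (\<lambda>z. g z - h' z) k = 0)"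
  show "h' = ?h"
  proof (rule bergman_eqI)
    fix k
    have "L2_inner (\<lambda>z. g z - h' z) (disc_power k) = 0"
      using h' disc_power_bergman by blast
    then show "L2_inner h' (\<lambda>z. z ^ k) = L2_inner ?h (\<lambda>z. z ^ k)"
      using h' by (simp add: L2_inner_disc_power hk L2_inner_diff_left g bergman_L2 L2_disc_power)
  qed (use h h' in auto)
qed

lemma bergman_projection_in: "g \<in> L2_disc \<Longrightarrow> bergman_projection g \<in> bergman_space"
  by (simp add: bergman_projection_eq disc_series_in_bergman square_summable_coeff)

lemma monomial_coeff_projection:
  "g \<in> L2_disc \<Longrightarrow> monomial_coeff (bergman_projection g) = monomial_coeff g"
  by (simp add: bergman_projection_eq monomial_coeff_disc_series square_summable_coeff)

lemma L2_inner_projection_left: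
  assumes g: "g \<in> L2_disc" and h: "h \<in> bergman_space"
  shows "L2_inner (bergman_projection g) h = L2_inner g h"
proof -
  have P: "bergman_projection g \<in> L2_disc"
    by (rule bergman_L2[OF bergman_projection_in[OF g]])
  have "L2_inner (bergman_projection g) (\<lambda>z. z ^ k) = L2_inner g (\<lambda>z. z ^ k)" for k
    by (simp only: L2_inner_power_eq_coeff monomial_coeff_projection[OF g])
  then show ?thesis
    using L2_inner_bergman_sums[OF P h] L2_inner_bergman_sums[OF g h] sums_unique2 by simp
qed

lemma L2_norm_projection_le:
  assumes g: "g \<in> L2_disc"
  shows "L2_norm (bergman_projection g) \<le> L2_norm g"
proof -
  let ?b = "\<lambda>k. pi / (real k + 1) * (norm (monomial_coeff g k))\<^sup>2"
  have sums: "?b sums (L2_norm (bergman_projection g))\<^sup>2"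
    using Parseval_bergman[OF bergman_projection_in[OF g]]
    by (simp only: monomial_coeff_projection[OF g])
  have "suminf ?b \<le> (L2_norm g)\<^sup>2"
    using sums by (intro suminf_le_const Bessel_inequality g) (auto dest: sums_summable)
  then have "(L2_norm (bergman_projection g))\<^sup>2 \<le> (L2_norm g)\<^sup>2"
    using sums by (simp only: sums_iff)
  then show ?thesis by (rule power2_le_imp_le) (rule L2_norm_nonneg)
qed

section \<open>Toeplitz operators with bounded symbols\<close>

definition bounded_symbol :: "(complex \<Rightarrow> complex) \<Rightarrow> bool" where
  "bounded_symbol p \<longleftrightarrow> p \<in> borel_measurable disc_area \<and> (\<exists>C. \<forall>z\<in>ball 0 1. norm (p z) \<le> C)"

lemma bounded_symbol_L2:
  "bounded_symbol p \<Longrightarrow> u \<in> L2_disc \<Longrightarrow> (\<lambda>z. p z * u z) \<in> L2_disc"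
  unfolding bounded_symbol_def by (elim conjE exE) (rule L2_disc_bounded_mult, auto)

lemma bounded_symbol_cnj: "bounded_symbol p \<Longrightarrow> bounded_symbol (\<lambda>z. cnj (p z))"
  unfolding bounded_symbol_def by (auto intro: borel_measurable_cnj)

lemma bounded_symbol_scale:
  assumes "bounded_symbol p"
  shows "bounded_symbol (\<lambda>z. c * p z)"
proof -
  obtain C where C: "\<forall>z\<in>ball 0 1. norm (p z) \<le> C" and m: "p \<in> borel_measurable disc_area"
    using assms by (auto simp: bounded_symbol_def)
  have "\<forall>z\<in>ball 0 1. norm (c * p z) \<le> norm c * C"
    using C by (auto simp: norm_mult intro!: mult_left_mono)
  with m show ?thesis
    unfolding bounded_symbol_def by (intro conjI borel_measurable_times borel_measurable_const) blast+
qed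

lemma bounded_symbol_add:
  assumes "bounded_symbol p" "bounded_symbol q"
  shows "bounded_symbol (\<lambda>z. p z + q z)"
proof -
  obtain C where C: "\<forall>z\<in>ball 0 1. norm (p z) \<le> C" and p: "p \<in> borel_measurable disc_area"
    using assms by (auto simp: bounded_symbol_def)
  obtain D where D: "\<forall>z\<in>ball 0 1. norm (q z) \<le> D" and q: "q \<in> borel_measurable disc_area"
    using assms by (auto simp: bounded_symbol_def)
  have "\<forall>z\<in>ball 0 1. norm (p z + q z) \<le> C + D"
    using C D by (auto intro: norm_triangle_mono)
  with p q show ?thesis
    unfolding bounded_symbol_def by (intro conjI borel_measurable_add) blast+
qed

lemma bounded_symbol_monomial: "bounded_symbol (\<lambda>z. z ^ a * cnj z ^ b)"
  unfolding bounded_symbol_def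
  by (intro conjI exI[of _ 1] ballI measurable_continuous_on_disc continuous_intros)
     (auto simp: norm_mult norm_power intro!: mult_le_one power_le_one)

lemma toeplitz_bergman:
  "bounded_symbol p \<Longrightarrow> u \<in> bergman_space \<Longrightarrow> toeplitz p u \<in> bergman_space"
  unfolding toeplitz_def by (intro bergman_projection_in bounded_symbol_L2 bergman_L2)

lemma L2_inner_toeplitz_left:
  "bounded_symbol p \<Longrightarrow> u \<in> bergman_space \<Longrightarrow> v \<in> bergman_space \<Longrightarrow>
   L2_inner (toeplitz p u) v = L2_inner (\<lambda>z. p z * u z) v"
  unfolding toeplitz_def by (intro L2_inner_projection_left bounded_symbol_L2 bergman_L2)

lemma L2_inner_toeplitz_adjoint:
  assumes p: "bounded_symbol p" and u: "u \<in> bergman_space" and v: "v \<in> bergman_space"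
  shows "L2_inner (toeplitz p u) v = L2_inner u (toeplitz (\<lambda>z. cnj (p z)) v)"
proof -
  have "L2_inner u (toeplitz (\<lambda>z. cnj (p z)) v) = cnj (L2_inner (toeplitz (\<lambda>z. cnj (p z)) v) u)"
    by (rule L2_inner_commute)
  also have "\<dots> = cnj (L2_inner (\<lambda>z. cnj (p z) * v z) u)"
    by (simp only: L2_inner_toeplitz_left[OF bounded_symbol_cnj[OF p] v u])
  also have "\<dots> = L2_inner u (\<lambda>z. cnj (p z) * v z)"
    by (rule L2_inner_commute[symmetric])
  also have "\<dots> = L2_inner (toeplitz p u) v"
    by (simp only: L2_inner_toeplitz_left[OF p u v] L2_inner_mult_left)
  finally show ?thesis by simp
qed

lemma L2_inner_toeplitz_power:
  assumes "bounded_symbol p" "u \<in> bergman_space"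
  shows "L2_inner (toeplitz p u) (\<lambda>z. z ^ k) = L2_inner (\<lambda>z. p z * u z) (\<lambda>z. z ^ k)"
  using L2_inner_toeplitz_left[OF assms disc_power_bergman[of k]]
  by (simp only: L2_inner_disc_power)

lemma toeplitz_add:
  assumes p: "bounded_symbol p" and u: "u \<in> bergman_space" and v: "v \<in> bergman_space"
  shows "toeplitz p (\<lambda>z. u z + v z) = (\<lambda>z. toeplitz p u z + toeplitz p v z)"
  by (rule bergman_eqI)
     (simp_all add: assms toeplitz_bergman bergman_add L2_inner_toeplitz_power L2_inner_add_left
       bergman_L2 L2_disc_power bounded_symbol_L2 distrib_left)

lemma toeplitz_scale:
  assumes p: "bounded_symbol p" and u: "u \<in> bergman_space"
  shows "toeplitz p (\<lambda>z. c * u z) = (\<lambda>z. c * toeplitz p u z)"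
  by (rule bergman_eqI)
     (simp_all add: assms toeplitz_bergman bergman_scale L2_inner_toeplitz_power L2_inner_scale_left
       mult.left_commute)

lemma toeplitz_symbol_add_scale:
  assumes p: "bounded_symbol p" and q: "bounded_symbol q" and u: "u \<in> bergman_space"
  shows "toeplitz (\<lambda>z. p z + c * q z) u = (\<lambda>z. toeplitz p u z + c * toeplitz q u z)"
proof (rule bergman_eqI)
  have pq: "bounded_symbol (\<lambda>z. p z + c * q z)"
    by (intro bounded_symbol_add bounded_symbol_scale p q)
  show "toeplitz (\<lambda>z. p z + c * q z) u \<in> bergman_space"
    by (rule toeplitz_bergman[OF pq u])
  show "(\<lambda>z. toeplitz p u z + c * toeplitz q u z) \<in> bergman_space"
    by (intro bergman_add bergman_scale toeplitz_bergman p q u)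
  fix k
  have pu: "(\<lambda>z. p z * u z) \<in> L2_disc" "(\<lambda>z. c * (q z * u z)) \<in> L2_disc"
    by (intro bounded_symbol_L2 L2_disc_scale p q bergman_L2 u)+
  have pu': "toeplitz p u \<in> L2_disc" "(\<lambda>z. c * toeplitz q u z) \<in> L2_disc"
    by (intro bergman_L2 bergman_scale toeplitz_bergman p q u)+
  show "L2_inner (toeplitz (\<lambda>z. p z + c * q z) u) (\<lambda>z. z ^ k)
      = L2_inner (\<lambda>z. toeplitz p u z + c * toeplitz q u z) (\<lambda>z. z ^ k)"
    using L2_inner_add_left[OF pu L2_disc_power] L2_inner_add_left[OF pu' L2_disc_power]
    by (simp add: L2_inner_toeplitz_power p q pq u L2_inner_scale_left distrib_right mult.assoc)
qed

lemma bounded_operator_toeplitz: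
  assumes p: "bounded_symbol p"
  shows "bounded_operator (toeplitz p)"
proof -
  obtain C where C: "\<And>z. z \<in> ball 0 1 \<Longrightarrow> norm (p z) \<le> C"
    using p unfolding bounded_symbol_def by blast
  have C0: "C \<ge> 0" using order_trans[OF norm_ge_zero C[of 0]] by simp
  have "L2_norm (toeplitz p u) \<le> C * L2_norm u" if u: "u \<in> bergman_space" for u
  proof -
    have pu: "(\<lambda>z. p z * u z) \<in> L2_disc" by (intro bounded_symbol_L2 p bergman_L2 u)
    have "L2_norm (toeplitz p u) \<le> L2_norm (\<lambda>z. p z * u z)"
      unfolding toeplitz_def by (rule L2_norm_projection_le[OF pu])
    also have "\<dots> \<le> C * L2_norm u"
    proof (rule power2_le_imp_le)
      have "(LINT z|disc_area. (norm (p z * u z))\<^sup>2) \<le> (LINT z|disc_area. C\<^sup>2 * (norm (u z))\<^sup>2)"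
        using C
        by (intro integral_mono L2_disc_integrable[OF pu] integrable_mult_right
            L2_disc_integrable[OF bergman_L2[OF u]])
           (auto simp: norm_mult power_mult_distrib simp del: mem_ball intro!: mult_right_mono power_mono)
      then show "(L2_norm (\<lambda>z. p z * u z))\<^sup>2 \<le> (C * L2_norm u)\<^sup>2"
        by (simp add: L2_norm_power2 power_mult_distrib)
      show "0 \<le> C * L2_norm u" using C0 L2_norm_nonneg by simp
    qed
    finally show ?thesis .
  qed
  then show ?thesis
    unfolding bounded_operator_def
    by (intro conjI ballI allI toeplitz_bergman toeplitz_add toeplitz_scale p exI[of _ C])
qed

lemma hilbert_adjoint_toeplitz:
  assumes p: "bounded_symbol p" and v: "v \<in> bergman_space"
  shows "hilbert_adjoint (toeplitz p) v = toeplitz (\<lambda>z. cnj (p z)) v"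
  unfolding hilbert_adjoint_def
proof (rule the_equality)
  let ?w = "toeplitz (\<lambda>z. cnj (p z)) v"
  show w: "?w \<in> bergman_space \<and> (\<forall>u\<in>bergman_space. L2_inner (toeplitz p u) v = L2_inner u ?w)"
    using L2_inner_toeplitz_adjoint[OF p _ v] toeplitz_bergman[OF bounded_symbol_cnj[OF p] v] by blast
  fix w' assume w': "w' \<in> bergman_space \<and> (\<forall>u\<in>bergman_space. L2_inner (toeplitz p u) v = L2_inner u w')"
  show "w' = ?w"
  proof (rule bergman_eqI)
    fix k
    have "L2_inner (disc_power k) w' = L2_inner (disc_power k) ?w"
      using w w' disc_power_bergman by metis
    then have "L2_inner w' (disc_power k) = L2_inner ?w (disc_power k)"
      by (simp only: L2_inner_commute[of _ "disc_power k"])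
    then show "L2_inner w' (\<lambda>z. z ^ k) = L2_inner ?w (\<lambda>z. z ^ k)"
      by (simp only: L2_inner_disc_power)
  qed (use w w' in auto)
qed

text \<open>Since the adjoint has the conjugate symbol, the quadratic form of the self-commutator is the
  difference of the squared norms of the two images of \<open>u\<close>.\<close>

lemma hyponormal_toeplitzI:
  assumes p: "bounded_symbol p"
    and le: "\<And>u. u \<in> bergman_space \<Longrightarrow> L2_norm (toeplitz (\<lambda>z. cnj (p z)) u) \<le> L2_norm (toeplitz p u)"
  shows "hyponormal (toeplitz p)"
  unfolding hyponormal_def
proof (intro conjI ballI bounded_operator_toeplitz p)
  fix u assume u: "u \<in> bergman_space"
  let ?q = "\<lambda>z. cnj (p z)"
  have q: "bounded_symbol ?q" using p by (rule bounded_symbol_cnj)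
  have Tu: "toeplitz p u \<in> bergman_space" "toeplitz ?q u \<in> bergman_space"
    by (intro toeplitz_bergman p q u)+
  have "L2_inner (self_commutator (toeplitz p) u) u
      = L2_inner (toeplitz ?q (toeplitz p u)) u - L2_inner (toeplitz p (toeplitz ?q u)) u"
    unfolding self_commutator_def hilbert_adjoint_toeplitz[OF p u] hilbert_adjoint_toeplitz[OF p Tu(1)]
    by (intro L2_inner_diff_left bergman_L2 toeplitz_bergman p q u)
  also have "\<dots> = L2_inner (toeplitz p u) (toeplitz p u) - L2_inner (toeplitz ?q u) (toeplitz ?q u)"
    using L2_inner_toeplitz_adjoint[OF q Tu(1) u] L2_inner_toeplitz_adjoint[OF p Tu(2) u] by simp
  also have "\<dots> = of_real ((L2_norm (toeplitz p u))\<^sup>2 - (L2_norm (toeplitz ?q u))\<^sup>2)"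
    by (simp only: L2_inner_self of_real_diff)
  also have "\<dots> \<in> \<real>\<^sub>\<ge>\<^sub>0"
    using power_mono[OF le[OF u] L2_norm_nonneg, of 2] by (simp only: nonneg_Reals_of_real_iff)
  finally show "L2_inner (self_commutator (toeplitz p) u) u \<in> \<real>\<^sub>\<ge>\<^sub>0" .
qed

lemma L2_norm_add_scale:
  assumes f: "f \<in> L2_disc" and g: "g \<in> L2_disc"
  shows "(L2_norm (\<lambda>z. f z + of_real c * g z))\<^sup>2
       = (L2_norm f)\<^sup>2 + 2 * c * Re (L2_inner f g) + c\<^sup>2 * (L2_norm g)\<^sup>2"
proof -
  have cg: "(\<lambda>z. of_real c * g z) \<in> L2_disc" using g by (rule L2_disc_scale)
  have fcg: "(\<lambda>z. f z + of_real c * g z) \<in> L2_disc" using f cg by (rule L2_disc_add)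
  have "of_real ((L2_norm (\<lambda>z. f z + of_real c * g z))\<^sup>2)
      = L2_inner f f + of_real c * L2_inner f g + of_real c * cnj (L2_inner f g)
        + of_real (c * c) * L2_inner g g"
    unfolding L2_inner_self[symmetric]
    by (simp add: L2_inner_add_left[OF f cg fcg] L2_inner_add_right[OF f cg] f g cg
        L2_inner_scale_left L2_inner_scale_right L2_inner_commute[of g f] algebra_simps)
  then have "Re (of_real ((L2_norm (\<lambda>z. f z + of_real c * g z))\<^sup>2))
      = Re (L2_inner f f + of_real c * L2_inner f g + of_real c * cnj (L2_inner f g)
        + of_real (c * c) * L2_inner g g)"
    by (rule arg_cong)
  then show ?thesis
    by (simp add: L2_inner_self power2_eq_square)
qed

text \<open>If \<open>T = A + c A\<^sup>*\<close> with real \<open>c\<close>, then \<open>T\<^sup>*T - TT\<^sup>* = (1 - c\<^sup>2) (A\<^sup>*A - AA\<^sup>*)\<close>: the mixed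
  terms cancel. Hence \<open>T\<close> inherits hyponormality from \<open>A\<close> as long as \<open>\<bar>c\<bar> \<le> 1\<close>.\<close>

lemma hyponormal_toeplitz_add_cnj:
  assumes f: "bounded_symbol f" and c: "\<bar>c\<bar> \<le> 1"
    and le: "\<And>u. u \<in> bergman_space \<Longrightarrow> L2_norm (toeplitz (\<lambda>z. cnj (f z)) u) \<le> L2_norm (toeplitz f u)"
  shows "hyponormal (toeplitz (\<lambda>z. f z + of_real c * cnj (f z)))"
proof (rule hyponormal_toeplitzI)
  have f': "bounded_symbol (\<lambda>z. cnj (f z))" using f by (rule bounded_symbol_cnj)
  show "bounded_symbol (\<lambda>z. f z + of_real c * cnj (f z))"
    by (intro bounded_symbol_add bounded_symbol_scale f f')
  fix u assume u: "u \<in> bergman_space"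
  let ?A = "toeplitz f u" and ?B = "toeplitz (\<lambda>z. cnj (f z)) u"
  have A: "?A \<in> L2_disc" and B: "?B \<in> L2_disc"
    by (intro bergman_L2 toeplitz_bergman f f' u)+
  have 1: "toeplitz (\<lambda>z. f z + of_real c * cnj (f z)) u = (\<lambda>z. ?A z + of_real c * ?B z)"
    by (rule toeplitz_symbol_add_scale[OF f f' u])
  have 2: "toeplitz (\<lambda>z. cnj (f z + of_real c * cnj (f z))) u = (\<lambda>z. ?B z + of_real c * ?A z)"
    using toeplitz_symbol_add_scale[OF f' f u, of "of_real c"] by simp
  have "(L2_norm (\<lambda>z. ?A z + of_real c * ?B z))\<^sup>2 - (L2_norm (\<lambda>z. ?B z + of_real c * ?A z))\<^sup>2
      = (1 - c\<^sup>2) * ((L2_norm ?A)\<^sup>2 - (L2_norm ?B)\<^sup>2)"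
    unfolding L2_norm_add_scale[OF A B] L2_norm_add_scale[OF B A] L2_inner_commute[of ?B ?A]
    by (simp add: algebra_simps)
  also have "\<dots> \<ge> 0"
    using c power_mono[OF le[OF u] L2_norm_nonneg, of 2]
    by (intro mult_nonneg_nonneg) (simp_all add: abs_square_le_1)
  finally show "L2_norm (toeplitz (\<lambda>z. cnj (f z + of_real c * cnj (f z))) u)
      \<le> L2_norm (toeplitz (\<lambda>z. f z + of_real c * cnj (f z)) u)"
    unfolding 1 2 by (intro power2_le_imp_le[OF _ L2_norm_nonneg]) simp
qed

section \<open>Monomial symbols act as weighted shifts\<close>

lemma monomial_coeff_toeplitz_monomial:
  assumes u: "u \<in> bergman_space"
  shows "monomial_coeff (toeplitz (\<lambda>z. z ^ a * cnj z ^ b) u) k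
       = (if a \<le> b + k then of_real ((real k + 1) / (real (b + k) + 1)) * monomial_coeff u (b + k - a) else 0)"
proof -
  let ?G = "\<lambda>z. z ^ (b + k) * cnj z ^ a"
  define m where "m = b + k - a"
  define x where "x = (if a \<le> b + k then cnj (monomial_coeff u m) * of_real (pi / (real (b + k) + 1)) else 0)"
  \<comment> \<open>Moving the symbol to the other side leaves a monomial, which sees a single coefficient of \<open>u\<close>.\<close>
  have "L2_inner (toeplitz (\<lambda>z. z ^ a * cnj z ^ b) u) (\<lambda>z. z ^ k) = L2_inner u ?G"
    unfolding L2_inner_toeplitz_power[OF bounded_symbol_monomial u] L2_inner_mult_left
    by (simp add: power_add mult_ac)
  also have "\<dots> = cnj (L2_inner ?G u)"
    by (rule L2_inner_commute)
  also have "L2_inner ?G u = x"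
  proof -
    have "(\<lambda>i. cnj (monomial_coeff u i) * L2_inner ?G (\<lambda>z. z ^ i)) = (\<lambda>i. if i = m then x else 0)"
      unfolding L2_inner_monomial_power x_def m_def by auto
    then have "(\<lambda>i. if i = m then x else 0) sums L2_inner ?G u"
      using L2_inner_bergman_sums[OF L2_disc_monomial u, of "b + k" a] by simp
    then show ?thesis
      using sums_single[of m "\<lambda>_. x"] sums_unique2 by blast
  qed
  finally show ?thesis
    unfolding monomial_coeff_def[of "toeplitz _ u"] by (simp add: x_def m_def)
qed

text \<open>After clearing denominators the difference of the two sides is a polynomial in \<open>y\<close>, \<open>n\<close>, \<open>d\<close>
  with nonnegative coefficients.\<close>

lemma shift_weight_le:
  fixes y n d :: real
  assumes "y > 0" "n \<ge> 0" "d \<ge> 0"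
  shows "y / (y + n + d)\<^sup>2 \<le> (y + 2 * d) / (y + n + 2 * d)\<^sup>2"
proof -
  have "0 \<le> 2 * d * (y + n) * n + d\<^sup>2 * (y + 4 * n) + 2 * d ^ 3"
    using assms by (intro add_nonneg_nonneg mult_nonneg_nonneg) auto
  also have "\<dots> = (y + 2 * d) * (y + n + d)\<^sup>2 - y * (y + n + 2 * d)\<^sup>2"
    by (simp add: algebra_simps power2_eq_square power3_eq_cube)
  finally have "y * (y + n + 2 * d)\<^sup>2 \<le> (y + 2 * d) * (y + n + d)\<^sup>2" by simp
  moreover have "(y + n + d)\<^sup>2 > 0" "(y + n + 2 * d)\<^sup>2 > 0"
    using assms by (auto intro!: zero_less_power add_pos_nonneg)
  ultimately show ?thesis by (simp add: divide_simps)
qed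

text \<open>One operator moves the coefficient of \<open>u\<close> at \<open>k + \<delta>\<close> down to \<open>k\<close>, the other moves it up to
  \<open>k + 2 * \<delta>\<close>. By \<open>shift_weight_le\<close> with \<open>y = k + 1\<close>, its contribution to the norm in the first
  case is at most that in the second. The initial terms up to \<open>2 * \<delta>\<close> of the larger sum
  have no counterpart and only increase it.\<close>

lemma L2_norm_toeplitz_monomial_cnj_le:
  fixes n \<delta> :: nat
  assumes u: "u \<in> bergman_space"
  shows "L2_norm (toeplitz (\<lambda>z. z ^ n * cnj z ^ (n + \<delta>)) u) \<le> L2_norm (toeplitz (\<lambda>z. z ^ (n + \<delta>) * cnj z ^ n) u)"
proof -
  let ?A = "toeplitz (\<lambda>z. z ^ (n + \<delta>) * cnj z ^ n) u" and ?B = "toeplitz (\<lambda>z. z ^ n * cnj z ^ (n + \<delta>)) u"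
  define \<alpha> where "\<alpha> k = pi / (real k + 1) * (norm (monomial_coeff ?A k))\<^sup>2" for k
  define \<beta> where "\<beta> k = pi / (real k + 1) * (norm (monomial_coeff ?B k))\<^sup>2" for k
  have sa: "\<alpha> sums (L2_norm ?A)\<^sup>2" and sb: "\<beta> sums (L2_norm ?B)\<^sup>2"
    unfolding \<alpha>_def \<beta>_def by (intro Parseval_bergman toeplitz_bergman bounded_symbol_monomial u)+
  have w: "pi / x * (norm (of_real (x / t) * v))\<^sup>2 = pi * (norm v)\<^sup>2 * (x / t\<^sup>2)"
    if "x > 0" for x t :: real and v :: complex
    using that by (simp add: norm_mult norm_divide power2_eq_square)
  have le: "\<beta> k \<le> \<alpha> (k + 2 * \<delta>)" for k
  proof -
    let ?v = "pi * (norm (monomial_coeff u (k + \<delta>)))\<^sup>2"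
    have cB: "monomial_coeff ?B k = of_real ((real k + 1) / (real k + 1 + real n + real \<delta>)) * monomial_coeff u (k + \<delta>)"
      unfolding monomial_coeff_toeplitz_monomial[OF u] by (simp add: add_ac)
    have cA: "monomial_coeff ?A (k + 2 * \<delta>)
        = of_real ((real k + 1 + 2 * real \<delta>) / (real k + 1 + real n + 2 * real \<delta>)) * monomial_coeff u (k + \<delta>)"
      unfolding monomial_coeff_toeplitz_monomial[OF u] by (simp add: add_ac)
    have "\<beta> k = ?v * ((real k + 1) / (real k + 1 + real n + real \<delta>)\<^sup>2)"
      unfolding \<beta>_def cB by (rule w) simp
    also have "\<dots> \<le> ?v * ((real k + 1 + 2 * real \<delta>) / (real k + 1 + real n + 2 * real \<delta>)\<^sup>2)"
      by (intro mult_left_mono shift_weight_le) auto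
    also have "\<dots> = pi / (real k + 1 + 2 * real \<delta>) * (norm (monomial_coeff ?A (k + 2 * \<delta>)))\<^sup>2"
      unfolding cA by (rule w[symmetric]) simp
    also have "\<dots> = \<alpha> (k + 2 * \<delta>)"
      by (simp add: \<alpha>_def add_ac)
    finally show ?thesis .
  qed
  have "(\<lambda>k. \<alpha> (k + 2 * \<delta>)) sums ((L2_norm ?A)\<^sup>2 - (\<Sum>k<2 * \<delta>. \<alpha> k))"
    by (rule sums_split_initial_segment[OF sa])
  from sums_le[OF le sb this]
  have "(L2_norm ?B)\<^sup>2 \<le> (L2_norm ?A)\<^sup>2 - (\<Sum>k<2 * \<delta>. \<alpha> k)" .
  also have "\<dots> \<le> (L2_norm ?A)\<^sup>2"
    by (simp add: \<alpha>_def sum_nonneg)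
  finally show ?thesis
    by (rule power2_le_imp_le) (rule L2_norm_nonneg)
qed

theorem theorem7:
  fixes \<delta> :: nat
  assumes "\<delta> \<ge> 1"
  shows "\<forall>n\<ge>1. \<exists>j\<ge>1. hyponormal (toeplitz (\<lambda>z::complex.
           z ^ (n + \<delta>) * cnj z ^ n
           + 1 / (2 * of_nat j + of_nat \<delta>) * cnj z ^ (j + \<delta>) * z ^ j))"
proof (intro allI impI)
  fix n :: nat assume n: "n \<ge> 1"
  \<comment> \<open>\<open>j = n\<close> makes the second summand a real multiple of the conjugate of the first.\<close>
  define c where "c = 1 / (2 * real n + real \<delta>)"
  let ?f = "\<lambda>z::complex. z ^ (n + \<delta>) * cnj z ^ n"
  have "hyponormal (toeplitz (\<lambda>z. ?f z + of_real c * cnj (?f z)))"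
  proof (rule hyponormal_toeplitz_add_cnj[OF bounded_symbol_monomial])
    show "\<bar>c\<bar> \<le> 1" using n by (simp add: c_def)
    fix u assume "u \<in> bergman_space"
    then show "L2_norm (toeplitz (\<lambda>z. cnj (?f z)) u) \<le> L2_norm (toeplitz ?f u)"
      using L2_norm_toeplitz_monomial_cnj_le[of u n \<delta>] by (simp add: mult.commute)
  qed
  moreover have "complex_of_real c = 1 / (2 * of_nat n + of_nat \<delta>)"
    by (simp add: c_def)
  ultimately have "hyponormal (toeplitz (\<lambda>z::complex. z ^ (n + \<delta>) * cnj z ^ n
           + 1 / (2 * of_nat n + of_nat \<delta>) * cnj z ^ (n + \<delta>) * z ^ n))"
    by (simp only: complex_cnj_mult complex_cnj_power complex_cnj_cnj mult.assoc)
  with n show "\<exists>j\<ge>1. hyponormal (toeplitz (\<lambda>z::complex.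
           z ^ (n + \<delta>) * cnj z ^ n
           + 1 / (2 * of_nat j + of_nat \<delta>) * cnj z ^ (j + \<delta>) * z ^ j))"
    by blast
qed

end
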